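(* Let $\ell,m,k$ be positive integers. (1) Let $y_1,\dots,y_\ell,x_1,\dots,x_k,z_1,\dots,z_m$ be complex variables. Let $\pmb s\in T((\ell,\{1\}^k),\mathbb C)$ be the tableau with first row $(y_1,\dots,y_\ell)$ and first column $(y_1,x_1,\dots,x_k)$, and let $\pmb t\in T((m),\mathbb C)$ be the one-row tableau $(z_1,\dots,z_m)$. Assume $\pmb s\in W_{(\ell,\{1\}^k)}$, $\pmb t\in W_{(m)}$, $\Re(y_i)>1$ for $1\le i\le \ell$, and $\Re(z_j)>1$ for $1\le j\le \min(\ell-1,m)$. Then $$\sum_{sym}\zeta_{(\ell,\{1\}^k)}(\pmb s)\cdot\zeta_{(m)}(\pmb t)=\sum_{sym}\ \sum_{\pmb u_\mu\in \pmb U_H}\zeta_\mu(\pmb u_\mu),$$ where $\pmb U_H=\pmb U_H(\pmb s,\pmb t)$ is the set of tableaux obtained from $\pmb s$ and $\pmb t$ by the pushing rule, $\mu$ is the shape of $\pmb u_\mu$, and $\sum_{sym}$ is the sum over all permutations of $S=\{y_1,\dots,y_\ell\}\cup\{z_j: 1\le j\le \min(\ell-1,m)\}$, regarded as a set of distinct indeterminates. (2) Let $x_1,\dots,x_k,y_1,\dots,y_\ell,z_1,\dots,z_m$ be complex variables. Let $\pmb s\in T((\ell+1,\{1\}^{k-1}),\mathbb C)$ be the tableau with first row $(x_1,y_1,\dots,y_\ell)$ and first column $(x_1,x_2,\dots,x_k)$, and let $\pmb t\in T((\{1\}^m),\mathbb C)$ be the one-column tableau with entries $z_1,\dots,z_m$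 from top to bottom. Assume $\pmb s\in W_{(\ell+1,\{1\}^{k-1})}$, $\pmb t\in W_{(\{1\}^m)}$, $\Re(x_i)>1$ for $1\le i\le k$, and $\Re(z_j)>1$ for $1\le j\le \min(k-1,m)$. Then $$\sum_{sym}\zeta_{(\ell+1,\{1\}^{k-1})}(\pmb s)\cdot\zeta_{(\{1\}^m)}(\pmb t)=\sum_{sym}\ \sum_{\pmb u_\mu\in \pmb U_E}\zeta_\mu(\pmb u_\mu),$$ where $\pmb U_E=\pmb U_E(\pmb s,\pmb t)$ is the set of tableaux obtained from $\pmb s$ and $\pmb t$ by the pushing rule, $\mu$ is the shape of $\pmb u_\mu$, and $\sum_{sym}$ is the sum over all permutations of $S=\{x_1,\dots,x_k\}\cup\{z_j: 1\le j\le\min(k-1,m)\}$, regarded as a set of distinct indeterminates.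
   Context: A partition is a non-increasing finite sequence $\lambda=(\lambda_1,\dots,\lambda_r)$ of positive integers; $\{1\}^k$ denotes $1$ repeated $k$ times. Its diagram is $D(\lambda)=\{(i,j): 1\le i\le r,\ 1\le j\le\lambda_i\}$ (row $i$, column $j$, as for matrices). $T(\lambda,X)$ is the set of fillings $(t_{ij})_{(i,j)\in D(\lambda)}$ with $t_{ij}\in X$. $SSYT(\lambda)$ is the set of $(m_{ij})\in T(\lambda,\mathbb N)$ (positive integers) weakly increasing along rows from left to right and strictly increasing down columns. The Schur multiple zeta function is $$\zeta_\lambda(\pmb s)=\sum_{(m_{ij})\in SSYT(\lambda)}\ \prod_{(i,j)\in D(\lambda)} m_{ij}^{-s_{ij}},\qquad \pmb s=(s_{ij})\in T(\lambda,\mathbb C).$$ $C(\lambda)$ is the set of corners of $\lambda$ (boxes $(i,j)\in D(\lambda)$ with $(i+1,j),(i,j+1)\notin D(\lambda)$), and $W_\lambda$ is the set of $\pmb s\in T(\lambda,\mathbb C)$ with $\Re(s_{ij})\ge1$ for $(i,j)\in D(\lambda)\setminus C(\lambda)$ and $\Re(s_{ij})>1$ for $(i,j)\in C(\lambda)$; the series converges absolutely on $W_\lambda$. Pushing rule, row version ($\pmb U_H$): given $\pmb s\in T(\lambda,\mathbb C)$ and a row $\pmb t=(t_1,\dots,t_r)$, insert $t_1,\dots,t_r$ successively. Each $t_i$ is either put on top of some column and that column is pushed down by one box (so $t_i$ becomes the new top entry, in row 1, and every old entry of that column moves down one row), or is put immediately to the right of the right-most box of the first row. $t_{i+1}$ must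 be put in a column strictly to the right of that of $t_i$ (not necessarily adjacent). If after some insertion the shape is not the diagram of a partition, that choice is discarded. $\pmb U_H$ is the set of all resulting tableaux. Pushing rule, column version ($\pmb U_E$): given $\pmb s\in T(\lambda,\mathbb C)$ and a column $\pmb t$ with entries $t_1,\dots,t_r$ from top to bottom, insert $t_1,\dots,t_r$ successively. Each $t_i$ is either put to the left of some row and that row is pushed to the right by one box (so $t_i$ becomes the entry in column 1 and every old entry of that row moves one column to the right), or is put immediately below the bottommost box of the first column. $t_{i+1}$ must be put in a row strictly below that of $t_i$ (not necessarily adjacent). Choices leading to a shape that is not the diagram of a partition are discarded. $\pmb U_E$ is the set of all resulting tableaux. In both cases tableaux are distinguished as fillings by formal indeterminates (so distinct choices are counted separately even if some variables take equal values). $\sum_{sym}$ on an expression means: sum, over all permutations of the indeterminates in $S$, of the expression with the variables substituted accordingly. *)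

theory Defs
  imports "HOL-Analysis.Analysis" "HOL-Combinatorics.Combinatorics"
begin

definition is_partition :: "nat list \<Rightarrow> bool" where
  "is_partition lam \<longleftrightarrow> sorted_wrt (\<ge>) lam \<and> (\<forall>p\<in>set lam. 0 < p)"

(* Boxes are counted from 1 whereas list positions are counted from 0. *)
definition diagram :: "nat list \<Rightarrow> (nat \<times> nat) set" where
  "diagram lam = {(i, j). 1 \<le> i \<and> i \<le> length lam \<and> 1 \<le> j \<and> j \<le> lam ! (i - 1)}"

(* Fillings are extensional, i.e. undefined outside the diagram, so that equality of
   fillings of a given shape is equality of all their entries. *)
definition tableaux :: "nat list \<Rightarrow> 'a set \<Rightarrow> (nat \<times> nat \<Rightarrow> 'a) set" where
  "tableaux lam A = diagram lam \<rightarrow>\<^sub>E A"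

definition SSYT :: "nat list \<Rightarrow> (nat \<times> nat \<Rightarrow> nat) set" where
  "SSYT lam = {M \<in> tableaux lam {1..}.
     (\<forall>i j j'. (i, j) \<in> diagram lam \<and> (i, j') \<in> diagram lam \<and> j < j' \<longrightarrow> M (i, j) \<le> M (i, j')) \<and>
     (\<forall>i i' j. (i, j) \<in> diagram lam \<and> (i', j) \<in> diagram lam \<and> i < i' \<longrightarrow> M (i, j) < M (i', j))}"

definition schur_mzv :: "nat list \<Rightarrow> (nat \<times> nat \<Rightarrow> complex) \<Rightarrow> complex" where
  "schur_mzv lam s = (\<Sum>\<^sub>\<infinity>M\<in>SSYT lam. \<Prod>b\<in>diagram lam. of_nat (M b) powr (- s b))"

definition corners :: "nat list \<Rightarrow> (nat \<times> nat) set" where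
  "corners lam = {(i, j). (i, j) \<in> diagram lam \<and> (i + 1, j) \<notin> diagram lam \<and> (i, j + 1) \<notin> diagram lam}"

definition W :: "nat list \<Rightarrow> (nat \<times> nat \<Rightarrow> complex) set" where
  "W lam = {s \<in> tableaux lam UNIV.
     (\<forall>b \<in> diagram lam - corners lam. Re (s b) \<ge> 1) \<and> (\<forall>b \<in> corners lam. Re (s b) > 1)}"

(* The diagram and the filling after a has been put on top of column j and that column
   has been pushed down.  If column j is empty, this just adds the box (1, j). *)
definition push_down_diagram :: "nat \<Rightarrow> (nat \<times> nat) set \<Rightarrow> (nat \<times> nat) set" where
  "push_down_diagram j D =
     insert (1, j) ({(i, j'). (i, j') \<in> D \<and> j' \<noteq> j} \<union> {(i + 1, j) | i. (i, j) \<in> D})"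

definition push_down :: "nat \<Rightarrow> 'a \<Rightarrow> (nat \<times> nat) set \<Rightarrow> (nat \<times> nat \<Rightarrow> 'a) \<Rightarrow> (nat \<times> nat \<Rightarrow> 'a)" where
  "push_down j a D s = restrict
     (\<lambda>(i, j'). if j' = j then (if i = 1 then a else s (i - 1, j)) else s (i, j'))
     (push_down_diagram j D)"

definition push_right_diagram :: "nat \<Rightarrow> (nat \<times> nat) set \<Rightarrow> (nat \<times> nat) set" where
  "push_right_diagram i D =
     insert (i, 1) ({(i', j). (i', j) \<in> D \<and> i' \<noteq> i} \<union> {(i, j + 1) | j. (i, j) \<in> D})"

definition push_right :: "nat \<Rightarrow> 'a \<Rightarrow> (nat \<times> nat) set \<Rightarrow> (nat \<times> nat \<Rightarrow> 'a) \<Rightarrow> (nat \<times> nat \<Rightarrow> 'a)" where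
  "push_right i a D s = restrict
     (\<lambda>(i', j). if i' = i then (if j = 1 then a else s (i, j - 1)) else s (i', j))
     (push_right_diagram i D)"

(* Successive insertion of a row into the tableau s of shape lam, using only columns to the
   right of column c (c = 0: no restriction).  The columns of s are 1, ..., hd lam; column
   hd lam + 1 stands for the place immediately to the right of the first row.  The union over
   mu, which contains at most one partition, discards the choices whose shape is not the
   diagram of a partition.  The results are pairs of a shape and a filling of it. *)
primrec row_insertions ::
  "'a list \<Rightarrow> nat \<Rightarrow> nat list \<Rightarrow> (nat \<times> nat \<Rightarrow> 'a) \<Rightarrow> (nat list \<times> (nat \<times> nat \<Rightarrow> 'a)) set" where
  "row_insertions [] c lam s = {(lam, s)}"
| "row_insertions (a # ts) c lam s =
     (\<Union>j\<in>{c<..hd lam + 1}.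
        \<Union>mu\<in>{mu. is_partition mu \<and> diagram mu = push_down_diagram j (diagram lam)}.
          row_insertions ts j mu (push_down j a (diagram lam) s))"

primrec col_insertions ::
  "'a list \<Rightarrow> nat \<Rightarrow> nat list \<Rightarrow> (nat \<times> nat \<Rightarrow> 'a) \<Rightarrow> (nat list \<times> (nat \<times> nat \<Rightarrow> 'a)) set" where
  "col_insertions [] r lam s = {(lam, s)}"
| "col_insertions (a # ts) r lam s =
     (\<Union>i\<in>{r<..length lam + 1}.
        \<Union>mu\<in>{mu. is_partition mu \<and> diagram mu = push_right_diagram i (diagram lam)}.
          col_insertions ts i mu (push_right i a (diagram lam) s))"

(* t is a tableau of shape (m) in U_H and of shape (1, ..., 1), m times, in U_E. *)
definition U_H ::
  "nat list \<Rightarrow> (nat \<times> nat \<Rightarrow> 'a) \<Rightarrow> nat \<Rightarrow> (nat \<times> nat \<Rightarrow> 'a) \<Rightarrow> (nat list \<times> (nat \<times> nat \<Rightarrow> 'a)) set" where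
  "U_H lam s m t = row_insertions (map (\<lambda>j. t (1, j)) [1..<Suc m]) 0 lam s"

definition U_E ::
  "nat list \<Rightarrow> (nat \<times> nat \<Rightarrow> 'a) \<Rightarrow> nat \<Rightarrow> (nat \<times> nat \<Rightarrow> 'a) \<Rightarrow> (nat list \<times> (nat \<times> nat \<Rightarrow> 'a)) set" where
  "U_E lam s m t = col_insertions (map (\<lambda>i. t (i, 1)) [1..<Suc m]) 0 lam s"

(* The formal indeterminates x_i, y_i, z_i.  Tableaux are built and pushed with
   indeterminates as entries; complex values are only substituted afterwards. *)
datatype indet = X nat | Y nat | Z nat

fun assign ::
  "(nat \<Rightarrow> complex) \<Rightarrow> (nat \<Rightarrow> complex) \<Rightarrow> (nat \<Rightarrow> complex) \<Rightarrow> indet \<Rightarrow> complex" where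
  "assign x y z (X i) = x i"
| "assign x y z (Y i) = y i"
| "assign x y z (Z i) = z i"

definition subst_tab :: "nat list \<Rightarrow> (indet \<Rightarrow> complex) \<Rightarrow> (nat \<times> nat \<Rightarrow> indet) \<Rightarrow> (nat \<times> nat \<Rightarrow> complex)" where
  "subst_tab lam v s = (\<lambda>b\<in>diagram lam. v (s b))"

(* F v is the value of the expression under the substitution v. *)
definition sum_sym :: "indet set \<Rightarrow> (indet \<Rightarrow> complex) \<Rightarrow> ((indet \<Rightarrow> complex) \<Rightarrow> complex) \<Rightarrow> complex" where
  "sum_sym S v F = (\<Sum>p | p permutes S. F (v \<circ> p))"

(* First row (y_1, ..., y_l), first column (y_1, x_1, ..., x_k). *)
definition hook_H :: "nat \<Rightarrow> nat \<Rightarrow> nat \<times> nat \<Rightarrow> indet" where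
  "hook_H l k = restrict (\<lambda>(i, j). if i = 1 then Y j else X (i - 1)) (diagram (l # replicate k 1))"

(* First row (x_1, y_1, ..., y_l), first column (x_1, ..., x_k). *)
definition hook_E :: "nat \<Rightarrow> nat \<Rightarrow> nat \<times> nat \<Rightarrow> indet" where
  "hook_E l k = restrict (\<lambda>(i, j). if j = 1 then X i else Y (j - 1)) (diagram ((l + 1) # replicate (k - 1) 1))"

definition row_Z :: "nat \<Rightarrow> nat \<times> nat \<Rightarrow> indet" where
  "row_Z m = restrict (\<lambda>(i, j). Z j) (diagram [m])"

definition col_Z :: "nat \<Rightarrow> nat \<times> nat \<Rightarrow> indet" where
  "col_Z m = restrict (\<lambda>(i, j). Z i) (diagram (replicate m 1))"

end

theory Submission
  imports Defs
begin

text \<open>\<^bold>\<open>Reduction to counting.\<close>  All tableaux that occur carry the same letters (the indeterminates), each of them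
  once.  An integer filling of such a tableau is therefore a function \<open>f\<close> on the letters, and its term
  is the product of the \<open>f v powr - s v\<close>, wherever the letters stand.  A permutation \<open>p\<close> of \<open>S\<close> applied to
  the variables can be moved over to \<open>f\<close>.  Hence both sides are sums over the same functions \<open>f\<close>, and
  it suffices that for every single \<open>f\<close> the number of permutations \<open>p\<close> of \<open>S\<close> for which \<open>f \<circ> p\<close> makes
  both given tableaux semistandard equals the number of pairs of such a \<open>p\<close> and a pushed tableau that
  \<open>f \<circ> p\<close> makes semistandard (\<open>count_identity\<close>).  Absolute convergence has to be proved for the two
  factors on the left only (\<open>schur_summable\<close>): a function that contributes on the right also contributes
  on the left for some \<open>p\<close> (\<open>sum_infsum_eq_by_multiplicity\<close>).

  \<^bold>\<open>One proof for both parts.\<close>  Cut a tableau into the strips that the pushing rule moves: columns in the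
  first part, rows in the second.  The entries with equal index in all strips form a line.  Lines
  ascend with respect to a relation \<open>R\<close>, and every strip ascends with respect to the negated converse
  of \<open>R\<close>; here \<open>R\<close> is \<open>\<le>\<close> in the first part and \<open><\<close> in the second.  All that is used of \<open>R\<close> is that it is
  transitive and that \<open>R u w\<close> implies \<open>R u v\<close> or \<open>R v w\<close>.  From now on call the hook's first line
  \<open>y\<^sub>1, \<dots>, y\<^sub>l\<close>, its first strip \<open>y\<^sub>1, x\<^sub>1, \<dots>, x\<^sub>k\<close>, and the inserted letters \<open>z\<^sub>1, \<dots>, z\<^sub>m\<close>.

  \<^bold>\<open>The pushed tableaux.\<close>  Since all strips but the first have length one, the shape condition forces the
  pushed strips to be consecutive from the second one on, apart from an optional push of the first
  strip; the other letters go to the end of the first line (\<open>pushes_hook\<close>).  So a pushed tableau has two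
  long lines \<open>r\<close> and \<open>r'\<close> and a tail of its first strip: either \<open>r' = x\<^sub>1, y\<^sub>2, \<dots>, y\<^sub>i\<^sub>+\<^sub>1\<close>, where \<open>x\<^sub>1\<close> stands beside
  the letters that were pushed down, or \<open>r' = y\<^sub>1, \<dots>, y\<^sub>i\<^sub>+\<^sub>1\<close> with \<open>x\<^sub>1\<close> below \<open>y\<^sub>1\<close>.

  \<^bold>\<open>The count.\<close>  Fix \<open>f\<close> and consider all pairs of ascending lines \<open>(r, r')\<close> that use the letters \<open>y\<close> and \<open>z\<close>
  once each and in which the \<open>z\<^sub>j\<close> outside \<open>S\<close> stand at the end of \<open>r\<close> in their order.  If some strip
  violates its order, let \<open>j\<close> be the first index with \<open>R (r'\<^sub>j) (r\<^sub>j)\<close> and exchange the beginnings of the two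
  lines, so that they become \<open>r'\<^sub>1, \<dots>, r'\<^sub>j, r\<^sub>j, r\<^sub>j\<^sub>+\<^sub>1, \<dots>\<close> and \<open>r\<^sub>1, \<dots>, r\<^sub>j\<^sub>-\<^sub>1, r'\<^sub>j\<^sub>+\<^sub>1, \<dots>\<close>.  As in the proof of the
  Jacobi-Trudi identity for two rows, this is a bijection from the violating pairs onto all pairs
  whose lower line is shorter by one (\<open>bij_switch\<close>), and it leaves the \<open>z\<^sub>j\<close> outside \<open>S\<close> at the end.
  Let \<open>N\<^sub>p\<close> and \<open>G\<^sub>p\<close> count the pairs with \<open>length r' = p\<close> in which the first letter of \<open>r\<close>, respectively
  \<open>r'\<close>, may stand directly above \<open>x\<^sub>1\<close> in a strip.  The exchange gives \<open>G\<^sub>p\<^sub>+\<^sub>1 = below\<^sub>p + N\<^sub>p\<close>, and applied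
  to the lines \<open>r\<close> and \<open>x\<^sub>1, r'\<close> it gives \<open>N\<^sub>p = beside\<^sub>p + G\<^sub>p\<close>, where \<open>beside\<^sub>p\<close> and \<open>below\<^sub>p\<close> count the two kinds of
  pushed tableaux.  Iterating the two equations sums the pushed tableaux.  The left-hand side of the
  theorem is \<open>N\<^sub>m\<close> if \<open>m < l\<close>, with \<open>r\<close> the letters \<open>y\<close> and \<open>r'\<close> the letters \<open>z\<close>, and it is \<open>G\<^sub>l\<close> if \<open>m \<ge> l\<close>, with
  the roles of \<open>r\<close> and \<open>r'\<close> reversed.\<close>

section \<open>Partitions and their diagrams\<close>

text \<open>The pushing rule speaks of shapes as partitions and builds their diagrams; \<open>shape\<close> recovers the
  partition from the diagram.\<close>
definition shape :: "(nat \<times> nat) set \<Rightarrow> nat list" where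
  "shape D = (THE mu. is_partition mu \<and> diagram mu = D)"

definition young :: "(nat \<times> nat) set \<Rightarrow> bool" where
  "young D \<longleftrightarrow> finite D \<and> D \<subseteq> {1..} \<times> {1..} \<and>
     (\<forall>i j i' j'. (i, j) \<in> D \<and> 1 \<le> i' \<and> i' \<le> i \<and> 1 \<le> j' \<and> j' \<le> j \<longrightarrow> (i', j') \<in> D)"

lemma youngD:
  "young D \<Longrightarrow> (i, j) \<in> D \<Longrightarrow> 1 \<le> i' \<Longrightarrow> i' \<le> i \<Longrightarrow> 1 \<le> j' \<Longrightarrow> j' \<le> j \<Longrightarrow> (i', j') \<in> D"
  unfolding young_def by blast

lemma young_pos: "young D \<Longrightarrow> (i, j) \<in> D \<Longrightarrow> 1 \<le> i \<and> 1 \<le> j"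
  by (auto simp: young_def)

lemma finite_diagram: "finite (diagram lam)"
proof -
  have "diagram lam = (\<Union>i\<in>{1..length lam}. {i} \<times> {1..lam ! (i - 1)})"
    by (auto simp: diagram_def)
  then show ?thesis by simp
qed

lemma young_diagram:
  assumes "is_partition lam"
  shows "young (diagram lam)"
proof -
  have "lam ! (i - 1) \<le> lam ! (i' - 1)" if "1 \<le> i'" "i' \<le> i" "i \<le> length lam" for i i'
    using assms that
    by (cases "i' = i") (auto simp: is_partition_def sorted_wrt_iff_nth_less)
  then show ?thesis
    unfolding young_def
    by (auto simp: finite_diagram) (fastforce simp: diagram_def)+
qed

lemma diagram_inj:
  assumes "is_partition lam" "is_partition mu" "diagram lam = diagram mu"
  shows "lam = mu"
proof -
  have length_eq: "i < length lam \<longleftrightarrow> (Suc i, 1) \<in> diagram lam" if "is_partition lam" for lam i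
    using that by (auto simp: diagram_def is_partition_def Suc_le_eq)
  have "i < length lam \<longleftrightarrow> i < length mu" for i
    using assms length_eq by metis
  then have l: "length lam = length mu"
    by (metis linorder_neqE_nat less_irrefl)
  have nth: "j < lam ! i \<longleftrightarrow> (Suc i, Suc j) \<in> diagram lam" if "i < length lam" for lam i j
    using that by (auto simp: diagram_def)
  have "lam ! i = mu ! i" if "i < length lam" for i
    using nth[of i lam] nth[of i mu] that l assms(3) by (metis linorder_neqE_nat less_irrefl)
  with l show ?thesis by (simp add: nth_equalityI)
qed

lemma initial_segment:
  assumes "finite A" "A \<subseteq> {1..}" "\<And>i i'. i \<in> A \<Longrightarrow> 1 \<le> i' \<Longrightarrow> i' \<le> i \<Longrightarrow> i' \<in> A"
  shows "A = {1..card A}"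
proof (cases "A = {}")
  case False
  then have "A = {1..Max A}" using assms(1,2) by (auto intro: assms(3)[OF Max_in[OF assms(1)]])
  then show ?thesis by (metis card_atLeastAtMost diff_Suc_1)
qed auto

text \<open>The rows of a finite down-closed set are initial segments, so their cardinalities are the parts.
  This description by down-closure is symmetric in rows and columns, which lets one argument serve
  both pushing rules.\<close>
lemma partition_of_young:
  assumes "young D"
  shows "\<exists>mu. is_partition mu \<and> diagram mu = D"
proof -
  define row where "row i = {j. (i, j) \<in> D}" for i
  define col where "col = {i. (i, 1) \<in> D}"
  have "finite (fst ` D)" "finite (snd ` D)" using assms by (auto simp: young_def)
  moreover have "col \<subseteq> fst ` D" "row i \<subseteq> snd ` D" for i
    by (force simp: row_def col_def)+
  ultimately have fin: "finite col" "finite (row i)" for i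
    by (blast intro: finite_subset)+
  have row: "row i = {1..card (row i)}" for i
  proof (rule initial_segment)
    show "row i \<subseteq> {1..}" using young_pos[OF assms] by (auto simp: row_def)
    show "j' \<in> row i" if "j \<in> row i" "1 \<le> j'" "j' \<le> j" for j j'
      using youngD[OF assms, of i j i j'] young_pos[OF assms, of i j] that by (simp add: row_def)
  qed (rule fin)
  have col: "col = {1..card col}"
  proof (rule initial_segment)
    show "col \<subseteq> {1..}" using young_pos[OF assms] by (auto simp: col_def)
    show "i' \<in> col" if "i \<in> col" "1 \<le> i'" "i' \<le> i" for i i'
      using youngD[OF assms, of i 1 i' 1] that by (simp add: col_def)
  qed (rule fin)
  define mu where "mu = map (\<lambda>i. card (row (Suc i))) [0..<card col]"
  have "row i \<subseteq> row i'" if "1 \<le> i'" "i' \<le> i" for i i'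
  proof
    fix j assume "j \<in> row i"
    then show "j \<in> row i'"
      using youngD[OF assms, of i j i' j] young_pos[OF assms, of i j] that by (simp add: row_def)
  qed
  then have anti: "card (row i) \<le> card (row i')" if "1 \<le> i'" "i' \<le> i" for i i'
    using card_mono[OF fin(2)] that by blast
  have pos: "0 < card (row (Suc i))" if "i < card col" for i
  proof -
    have "Suc i \<in> col" using that by (subst col) auto
    then have "1 \<in> row (Suc i)" by (auto simp: row_def col_def)
    then show ?thesis using fin by (auto simp: card_gt_0_iff)
  qed
  have "is_partition mu"
    using anti pos by (auto simp: is_partition_def mu_def sorted_wrt_iff_nth_less)
  moreover have "diagram mu = D"
  proof (rule set_eqI, clarify)
    fix i j
    have "(i, j) \<in> D \<longleftrightarrow> i \<in> col \<and> j \<in> row i"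
      using youngD[OF assms, of i j i 1] young_pos[OF assms, of i j] by (auto simp: row_def col_def)
    also have "\<dots> \<longleftrightarrow> i \<in> {1..card col} \<and> j \<in> {1..card (row i)}"
      using row col by metis
    also have "\<dots> \<longleftrightarrow> (i, j) \<in> diagram mu"
      by (auto simp: diagram_def mu_def)
    finally show "(i, j) \<in> diagram mu \<longleftrightarrow> (i, j) \<in> D" by simp
  qed
  ultimately show ?thesis by blast
qed

lemma shape:
  assumes "young D"
  shows "is_partition (shape D)" "diagram (shape D) = D"
proof -
  have "\<exists>!mu. is_partition mu \<and> diagram mu = D"
    using partition_of_young[OF assms] diagram_inj by blast
  from theI'[OF this] show "is_partition (shape D)" "diagram (shape D) = D"
    by (simp_all add: shape_def)
qed

lemma partitions_with_diagram:
  "{mu. is_partition mu \<and> diagram mu = D} = (if young D then {shape D} else {})"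
  using shape young_diagram diagram_inj by auto

lemma shape_diagram: "is_partition lam \<Longrightarrow> shape (diagram lam) = lam"
  by (rule diagram_inj) (simp_all add: shape young_diagram)

section \<open>Absolute convergence\<close>

lemma summable_powr_PiE:
  assumes "finite A" "0 < d"
  shows "(\<lambda>M. \<Prod>b\<in>A. real (M b) powr - (1 + d)) summable_on (A \<rightarrow>\<^sub>E {1..})"
proof -
  have "summable (\<lambda>n. real n powr - (1 + d))" using assms(2) by (simp add: summable_real_powr_iff)
  then have "(\<lambda>n. real n powr - (1 + d)) summable_on UNIV"
    by (rule summable_nonneg_imp_summable_on) simp
  then have "(\<lambda>n. real n powr - (1 + d)) summable_on {1..}"
    by (rule summable_on_subset_banach) simp
  then have "Infinite_Set_Sum.abs_summable_on (\<lambda>n. real n powr - (1 + d)) {1..}"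
    unfolding abs_summable_equivalent[symmetric] by simp
  then have "Infinite_Set_Sum.abs_summable_on (\<lambda>M. \<Prod>b\<in>A. real (M b) powr - (1 + d)) (A \<rightarrow>\<^sub>E {1..})"
    using assms(1) by (intro abs_summable_on_prod_PiE) auto
  then show ?thesis
    unfolding abs_summable_equivalent[symmetric] by (simp add: abs_prod)
qed

lemma norm_of_nat_powr: "1 \<le> n \<Longrightarrow> norm (of_nat n powr s :: complex) = real n powr Re s"
  using norm_powr_real_powr[of "of_nat n" s] by simp

text \<open>Moving right or down never decreases an entry, and a walk in these directions ends in a corner.
  The corner can be chosen independently of the filling.\<close>
lemma below_corner:
  assumes "b \<in> diagram lam"
  shows "\<exists>c\<in>corners lam. \<forall>M\<in>SSYT lam. M b \<le> M c"
proof -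
  obtain i j where b: "b = (i, j)" by fastforce
  define h where "h = (\<lambda>b :: nat \<times> nat. fst b + snd b)"
  define B where "B = {c \<in> diagram lam. \<forall>M\<in>SSYT lam. M b \<le> M c}"
  have "finite B" using finite_diagram by (simp add: B_def)
  moreover have "b \<in> B" using assms by (simp add: B_def)
  ultimately have "Max (h ` B) \<in> h ` B" "\<And>c'. c' \<in> B \<Longrightarrow> h c' \<le> Max (h ` B)"
    by (auto intro!: Max_in)
  then obtain c where c: "c \<in> B" "\<And>c'. c' \<in> B \<Longrightarrow> h c' \<le> h c"
    by auto
  obtain i' j' where ij: "c = (i', j')" by fastforce
  have "(i' + 1, j') \<notin> diagram lam"
  proof
    assume "(i' + 1, j') \<in> diagram lam"
    moreover from this c have "M c \<le> M (i' + 1, j')" if "M \<in> SSYT lam" for M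
      using that unfolding ij SSYT_def B_def by (auto intro!: less_imp_le)
    ultimately have "(i' + 1, j') \<in> B" using c by (auto simp: B_def intro: le_trans)
    with c(2) show False by (fastforce simp: h_def ij)
  qed
  moreover have "(i', j' + 1) \<notin> diagram lam"
  proof
    assume "(i', j' + 1) \<in> diagram lam"
    moreover from this c have "M c \<le> M (i', j' + 1)" if "M \<in> SSYT lam" for M
      using that unfolding ij SSYT_def B_def by auto
    ultimately have "(i', j' + 1) \<in> B" using c by (auto simp: B_def intro: le_trans)
    with c(2) show False by (fastforce simp: h_def ij)
  qed
  ultimately have "c \<in> corners lam" using c(1) by (auto simp: corners_def B_def ij)
  with c(1) show ?thesis by (auto simp: B_def)
qed

text \<open>The largest entry \<open>m\<close> of a filling stands in a corner, where the exponent exceeds one by at least some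
  \<open>e > 0\<close>.  That excess is shared out: every other factor \<open>M b powr - Re (s b)\<close> is at most
  \<open>M b powr - (1 + d) * m powr d\<close>, and for small \<open>d\<close> the corner can pay for all factors \<open>m powr d\<close>.  What
  remains is a product of convergent zeta series over independent entries.\<close>
lemma schur_summable:
  assumes "s \<in> W lam"
  shows "(\<lambda>M. \<Prod>b\<in>diagram lam. of_nat (M b) powr (- s b)) summable_on SSYT lam"
proof (cases "diagram lam = {}")
  case True
  then have "SSYT lam \<subseteq> {\<lambda>_. undefined}" by (auto simp: SSYT_def tableaux_def)
  then show ?thesis using finite_subset summable_on_finite by blast
next
  case False
  let ?D = "diagram lam"
  define n where "n = card ?D"
  have corners: "corners lam \<subseteq> ?D" by (auto simp: corners_def)
  have fin: "finite ?D" "finite (corners lam)"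
    using finite_diagram finite_subset[OF corners] by auto
  have "corners lam \<noteq> {}" using False below_corner by blast
  define e where "e = Min ((\<lambda>c. Re (s c) - 1) ` corners lam)"
  have e: "0 < e" "\<And>c. c \<in> corners lam \<Longrightarrow> 1 + e \<le> Re (s c)"
  proof -
    show "0 < e"
      unfolding e_def using assms fin \<open>corners lam \<noteq> {}\<close> by (subst Min_gr_iff) (auto simp: W_def)
    fix c assume "c \<in> corners lam"
    then have "e \<le> Re (s c) - 1" unfolding e_def using fin by (intro Min_le) auto
    then show "1 + e \<le> Re (s c)" by simp
  qed
  \<comment> \<open>The corner with the largest entry has to give \<open>d\<close> to its own exponent and \<open>d\<close> to each of fewer
    than \<open>n\<close> other boxes.\<close>
  define d where "d = e / (n + 1)"
  have "real n + 1 \<noteq> 0" by linarith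
  then have "d * (real n + 1) = e" unfolding d_def by (simp add: add.commute)
  then have d: "0 < d" "d + n * d = e"
    using e(1) by (simp add: d_def, simp add: algebra_simps)
  have bound: "norm (\<Prod>b\<in>?D. of_nat (M b) powr (- s b)) \<le> (\<Prod>b\<in>?D. real (M b) powr - (1 + d))"
    if M: "M \<in> SSYT lam" for M
  proof -
    have pos: "1 \<le> M b" if "b \<in> ?D" for b
      using M that by (auto simp: SSYT_def tableaux_def)
    define m where "m = Max (M ` ?D)"
    have m: "M b \<le> m" if "b \<in> ?D" for b
      using that fin by (simp add: m_def)
    have "m \<in> M ` ?D" unfolding m_def using fin False by simp
    then obtain c where c: "c \<in> corners lam" "M c = m"
      using below_corner M m corners by (metis imageE le_antisym subsetD)
    then have cD: "c \<in> ?D" and m1: "1 \<le> real m" using corners pos[of c] by auto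
    have factor: "real (M b) powr - Re (s b) \<le> real (M b) powr - (1 + d) * real m powr d"
      if "b \<in> ?D" for b
    proof -
      have 1: "1 \<le> real (M b)" using pos[OF that] by simp
      have "1 \<le> Re (s b)" using assms that by (cases "b \<in> corners lam") (auto simp: W_def less_imp_le)
      then have "real (M b) powr - Re (s b) \<le> real (M b) powr (- (1 + d) + d)"
        using 1 by (intro powr_mono) auto
      also have "\<dots> = real (M b) powr - (1 + d) * real (M b) powr d"
        by (rule powr_add)
      also have "\<dots> \<le> real (M b) powr - (1 + d) * real m powr d"
        using m[OF that] d by (intro mult_left_mono powr_mono2) auto
      finally show ?thesis .
    qed
    have factor_c: "real (M c) powr - Re (s c) \<le> real (M c) powr - (1 + d) * real m powr - (n * d)"
    proof -
      have "real (M c) powr - Re (s c) \<le> real (M c) powr (- (1 + d) + - (n * d))"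
        using e(2)[OF c(1)] d m1 c(2) by (intro powr_mono) auto
      then show ?thesis by (simp only: powr_add c(2))
    qed
    have "norm (\<Prod>b\<in>?D. of_nat (M b) powr (- s b)) = (\<Prod>b\<in>?D. real (M b) powr - Re (s b))"
      unfolding prod_norm[symmetric] by (intro prod.cong refl) (metis norm_of_nat_powr pos uminus_complex.simps(1))
    also have "\<dots> = real (M c) powr - Re (s c) * (\<Prod>b\<in>?D - {c}. real (M b) powr - Re (s b))"
      using fin cD by (simp add: prod.remove)
    also have "\<dots> \<le> (real (M c) powr - (1 + d) * real m powr - (n * d)) *
        (\<Prod>b\<in>?D - {c}. real (M b) powr - (1 + d) * real m powr d)"
      using factor factor_c by (intro mult_mono prod_mono prod_nonneg) auto
    also have "\<dots> = (\<Prod>b\<in>?D. real (M b) powr - (1 + d)) *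
        (real m powr - (n * d) * (real m powr d) ^ (n - 1))"
      using fin cD by (simp add: prod.distrib prod.remove[of ?D c] n_def)
    also have "real m powr - (n * d) * (real m powr d) ^ (n - 1) = real m powr (- (n * d) + (n - 1) * d)"
      using m1 by (simp only: powr_add) (simp add: powr_power mult.commute)
    also have "(\<Prod>b\<in>?D. real (M b) powr - (1 + d)) * real m powr (- (n * d) + (n - 1) * d) \<le>
        (\<Prod>b\<in>?D. real (M b) powr - (1 + d)) * 1"
    proof (intro mult_left_mono prod_nonneg)
      have "- (n * d) + real (n - 1) * d \<le> 0"
        using d by (auto simp: of_nat_diff mult_right_mono)
      then have "real m powr (- (n * d) + (n - 1) * d) \<le> real m powr 0"
        using m1 by (intro powr_mono) auto
      then show "real m powr (- (n * d) + (n - 1) * d) \<le> 1" using m1 by simp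
    qed auto
    finally show ?thesis by simp
  qed
  have "SSYT lam \<subseteq> ?D \<rightarrow>\<^sub>E {1..}" by (auto simp: SSYT_def tableaux_def)
  then have "(\<lambda>M. \<Prod>b\<in>?D. real (M b) powr - (1 + d)) summable_on SSYT lam"
    using summable_powr_PiE[OF fin(1) d(1)] summable_on_subset_banach by blast
  from Infinite_Sum.abs_summable_on_comparison_test'[OF this bound]
  show ?thesis by (simp add: summable_on_iff_abs_summable_on_complex)
qed

section \<open>Fillings as functions on letters\<close>

definition weight :: "'a set \<Rightarrow> ('a \<Rightarrow> complex) \<Rightarrow> ('a \<Rightarrow> nat) \<Rightarrow> complex" where
  "weight V w f = (\<Prod>v\<in>V. of_nat (f v) powr - w v)"

text \<open>If a tableau \<open>u\<close> shows every letter of \<open>V\<close> once, then a filling of its boxes is the same as a function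
  on the letters.\<close>
lemma bij_entries:
  assumes u: "bij_betw u (diagram mu) V"
  shows "bij_betw (\<lambda>f. restrict (f \<circ> u) (diagram mu))
    {f \<in> V \<rightarrow>\<^sub>E {1..}. restrict (f \<circ> u) (diagram mu) \<in> SSYT mu} (SSYT mu)"
proof (rule bij_betw_byWitness[where f' = "\<lambda>M. restrict (M \<circ> inv_into (diagram mu) u) V"])
  let ?D = "diagram mu" and ?g = "\<lambda>f. restrict (f \<circ> u) (diagram mu)"
  let ?h = "\<lambda>M. restrict (M \<circ> inv_into (diagram mu) u) V"
  have u1: "u b \<in> V" "inv_into ?D u (u b) = b" if "b \<in> ?D" for b
    using that u by (auto simp: bij_betw_def)
  have u2: "inv_into ?D u v \<in> ?D" "u (inv_into ?D u v) = v" if "v \<in> V" for v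
    using that u by (auto simp: bij_betw_def inv_into_into f_inv_into_f)
  show "\<forall>f\<in>{f \<in> V \<rightarrow>\<^sub>E {1..}. ?g f \<in> SSYT mu}. ?h (?g f) = f"
    using u2 by (auto simp: fun_eq_iff restrict_def PiE_def extensional_def)
  have gh: "?g (?h M) = M" if "M \<in> SSYT mu" for M
    using that u1 by (auto simp: fun_eq_iff restrict_def SSYT_def tableaux_def PiE_def extensional_def)
  then show "\<forall>M\<in>SSYT mu. ?g (?h M) = M" by blast
  have "?h M \<in> V \<rightarrow>\<^sub>E {1..}" if "M \<in> SSYT mu" for M
    using that u2 PiE_mem[of M ?D "\<lambda>_. {1..}"] by (simp add: SSYT_def tableaux_def restrict_PiE_iff)
  with gh show "?h ` SSYT mu \<subseteq> {f \<in> V \<rightarrow>\<^sub>E {1..}. ?g f \<in> SSYT mu}"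
    by (intro image_subsetI) (simp only: mem_Collect_eq simp_thms)
qed auto

lemma schur_mzv_letters:
  assumes u: "bij_betw u (diagram mu) V"
  shows "schur_mzv mu (subst_tab mu w u) =
      infsum (weight V w) {f \<in> V \<rightarrow>\<^sub>E {1..}. restrict (f \<circ> u) (diagram mu) \<in> SSYT mu}"
    and "subst_tab mu w u \<in> W mu \<Longrightarrow>
      weight V w summable_on {f \<in> V \<rightarrow>\<^sub>E {1..}. restrict (f \<circ> u) (diagram mu) \<in> SSYT mu}"
proof -
  let ?A = "{f \<in> V \<rightarrow>\<^sub>E {1..}. restrict (f \<circ> u) (diagram mu) \<in> SSYT mu}"
  let ?t = "\<lambda>M. \<Prod>b\<in>diagram mu. complex_of_nat (M b) powr (- subst_tab mu w u b)"
  have t: "?t (restrict (f \<circ> u) (diagram mu)) = weight V w f" for f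
    unfolding weight_def prod.reindex_bij_betw[OF u, symmetric]
    by (intro prod.cong refl) (simp add: subst_tab_def)
  show "schur_mzv mu (subst_tab mu w u) = infsum (weight V w) ?A"
    unfolding schur_mzv_def infsum_reindex_bij_betw[OF bij_entries[OF u], symmetric] t ..
  show "weight V w summable_on ?A" if "subst_tab mu w u \<in> W mu"
    using schur_summable[OF that]
    unfolding summable_on_reindex_bij_betw[OF bij_entries[OF u], symmetric] t .
qed

lemma summable_on_product:
  fixes f :: "'a \<Rightarrow> complex" and g :: "'b \<Rightarrow> complex"
  assumes "f summable_on A" "g summable_on B"
  shows "(\<lambda>(x, y). f x * g y) summable_on A \<times> B"
proof -
  have "(\<lambda>x. norm (f x)) summable_on A" "(\<lambda>y. norm (g y)) summable_on B"
    using assms by (simp_all add: summable_on_iff_abs_summable_on_complex)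
  then have "(\<lambda>(x, y). norm (f x) * norm (g y)) summable_on A \<times> B"
    by (intro summable_on_SigmaI[where g = "\<lambda>x. norm (f x) * infsum (\<lambda>y. norm (g y)) B"])
      (auto intro!: has_sum_cmult_right summable_on_cmult_left)
  then show ?thesis
    unfolding summable_on_iff_abs_summable_on_complex by (simp add: case_prod_unfold norm_mult)
qed

lemma infsum_product:
  fixes f :: "'a \<Rightarrow> complex" and g :: "'b \<Rightarrow> complex"
  assumes "f summable_on A" "g summable_on B"
  shows "infsum (\<lambda>(x, y). f x * g y) (A \<times> B) = infsum f A * infsum g B"
  using infsum_Sigma'_banach[OF summable_on_product[OF assms]]
  by (simp add: infsum_cmult_left' infsum_cmult_right')

text \<open>Restricting to two disjoint sets of letters splits a function on their union, so that a product
  of two series becomes one series over functions on all letters.\<close>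
lemma bij_merge:
  assumes "V1 \<inter> V2 = {}"
  shows "bij_betw (\<lambda>f. (restrict f V1, restrict f V2))
    {f \<in> V1 \<union> V2 \<rightarrow>\<^sub>E E. c1 (restrict f V1) \<and> c2 (restrict f V2)}
    ({f \<in> V1 \<rightarrow>\<^sub>E E. c1 f} \<times> {f \<in> V2 \<rightarrow>\<^sub>E E. c2 f})"
proof (rule bij_betw_byWitness[where f' = "\<lambda>(g, h). restrict (\<lambda>v. if v \<in> V1 then g v else h v) (V1 \<union> V2)"])
  let ?m = "\<lambda>(g, h). restrict (\<lambda>v. if v \<in> V1 then g v else h v) (V1 \<union> V2)"
  show "\<forall>f\<in>{f \<in> V1 \<union> V2 \<rightarrow>\<^sub>E E. c1 (restrict f V1) \<and> c2 (restrict f V2)}.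
      ?m (restrict f V1, restrict f V2) = f"
    by (auto simp: fun_eq_iff restrict_def PiE_def extensional_def)
  have *: "restrict (?m (g, h)) V1 = g" "restrict (?m (g, h)) V2 = h" "?m (g, h) \<in> V1 \<union> V2 \<rightarrow>\<^sub>E E"
    if "g \<in> V1 \<rightarrow>\<^sub>E E" "h \<in> V2 \<rightarrow>\<^sub>E E" for g h
    using that assms by (auto simp: fun_eq_iff restrict_def PiE_def extensional_def Pi_def)
  then show "\<forall>z\<in>{f \<in> V1 \<rightarrow>\<^sub>E E. c1 f} \<times> {f \<in> V2 \<rightarrow>\<^sub>E E. c2 f}. (restrict (?m z) V1, restrict (?m z) V2) = z"
    by auto
  show "?m ` ({f \<in> V1 \<rightarrow>\<^sub>E E. c1 f} \<times> {f \<in> V2 \<rightarrow>\<^sub>E E. c2 f}) \<subseteq>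
      {f \<in> V1 \<union> V2 \<rightarrow>\<^sub>E E. c1 (restrict f V1) \<and> c2 (restrict f V2)}"
    using * by auto
qed auto

lemma weight_union:
  "finite V1 \<Longrightarrow> finite V2 \<Longrightarrow> V1 \<inter> V2 = {} \<Longrightarrow>
    weight (V1 \<union> V2) w f = weight V1 w (restrict f V1) * weight V2 w (restrict f V2)"
  by (simp add: weight_def prod.union_disjoint)

lemma weight_product:
  assumes "finite V1" "finite V2" "V1 \<inter> V2 = {}"
    and "weight V1 w summable_on {f \<in> V1 \<rightarrow>\<^sub>E E. c1 f}" "weight V2 w summable_on {f \<in> V2 \<rightarrow>\<^sub>E E. c2 f}"
  shows "weight (V1 \<union> V2) w summable_on {f \<in> V1 \<union> V2 \<rightarrow>\<^sub>E E. c1 (restrict f V1) \<and> c2 (restrict f V2)}"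
    "infsum (weight V1 w) {f \<in> V1 \<rightarrow>\<^sub>E E. c1 f} * infsum (weight V2 w) {f \<in> V2 \<rightarrow>\<^sub>E E. c2 f} =
      infsum (weight (V1 \<union> V2) w) {f \<in> V1 \<union> V2 \<rightarrow>\<^sub>E E. c1 (restrict f V1) \<and> c2 (restrict f V2)}"
  using summable_on_product[OF assms(4,5)] infsum_product[OF assms(4,5)]
    summable_on_reindex_bij_betw[OF bij_merge[OF assms(3), of E c1 c2],
      of "\<lambda>(f, g). weight V1 w f * weight V2 w g"]
    infsum_reindex_bij_betw[OF bij_merge[OF assms(3), of E c1 c2],
      of "\<lambda>(f, g). weight V1 w f * weight V2 w g"]
  by (simp_all add: weight_union[OF assms(1-3), abs_def])

lemma bij_permute_letters:
  assumes "p permutes V"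
  shows "bij_betw (\<lambda>f. f \<circ> p) {f \<in> V \<rightarrow>\<^sub>E E. c (f \<circ> p)} {f \<in> V \<rightarrow>\<^sub>E E. c f}"
proof (rule bij_betw_byWitness[where f' = "\<lambda>f. f \<circ> inv p"])
  have PiE: "f \<circ> q \<in> V \<rightarrow>\<^sub>E E" if "f \<in> V \<rightarrow>\<^sub>E E" "q permutes V" for f q
    using that by (auto simp: PiE_def Pi_def extensional_def permutes_in_image permutes_not_in)
  have inv: "f \<circ> p \<circ> inv p = f" "f \<circ> inv p \<circ> p = f" for f :: "'a \<Rightarrow> 'b"
    using permutes_inv_o[OF assms] by (simp_all add: comp_assoc)
  show "(\<lambda>f. f \<circ> p) ` {f \<in> V \<rightarrow>\<^sub>E E. c (f \<circ> p)} \<subseteq> {f \<in> V \<rightarrow>\<^sub>E E. c f}"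
    using PiE assms by auto
  show "(\<lambda>f. f \<circ> inv p) ` {f \<in> V \<rightarrow>\<^sub>E E. c f} \<subseteq> {f \<in> V \<rightarrow>\<^sub>E E. c (f \<circ> p)}"
    using PiE permutes_inv[OF assms] by (auto simp: inv)
qed (simp_all add: permutes_inv_o[OF assms] comp_assoc)

lemma weight_permute:
  assumes "p permutes V"
  shows "weight V (w \<circ> p) (f \<circ> p) = weight V w f"
  unfolding weight_def
  using prod.permute[OF assms, of "\<lambda>v. of_nat (f v) powr - w v"] by (simp add: comp_def)

text \<open>Substituting permuted variables amounts to permuting the letters in the condition on \<open>f\<close>: replace the
  summation variable \<open>f\<close> by \<open>f \<circ> p\<close>.\<close>
lemma infsum_weight_permute:
  assumes "p permutes V"
  shows "infsum (weight V (w \<circ> p)) {f \<in> V \<rightarrow>\<^sub>E E. c f} = infsum (weight V w) {f \<in> V \<rightarrow>\<^sub>E E. c (f \<circ> p)}"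
    "weight V (w \<circ> p) summable_on {f \<in> V \<rightarrow>\<^sub>E E. c f} \<longleftrightarrow>
      weight V w summable_on {f \<in> V \<rightarrow>\<^sub>E E. c (f \<circ> p)}"
  using infsum_reindex_bij_betw[OF bij_permute_letters[OF assms, of E c], of "weight V (w \<circ> p)"]
    summable_on_reindex_bij_betw[OF bij_permute_letters[OF assms, of E c], of "weight V (w \<circ> p)"]
  by (simp_all add: weight_permute[OF assms])

lemma summable_on_finite_UN:
  fixes g :: "'a \<Rightarrow> 'b :: banach"
  assumes "finite P" "\<And>p. p \<in> P \<Longrightarrow> g summable_on A p"
  shows "g summable_on (\<Union>p\<in>P. A p)"
  using assms
proof (induction P rule: finite_induct)
  case (insert p P)
  have "g summable_on A p" using insert.prems by simp
  then have "g summable_on (A p - (\<Union>p\<in>P. A p))"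
    by (rule summable_on_subset_banach) auto
  moreover have "g summable_on (\<Union>p\<in>P. A p)" using insert by simp
  ultimately have "g summable_on ((A p - (\<Union>p\<in>P. A p)) \<union> (\<Union>p\<in>P. A p))"
    by (rule summable_on_Un_disjoint) auto
  then show ?case by (simp add: Un_commute)
qed simp

lemma sum_infsum_eq_infsum_multiplicity:
  fixes g :: "'a \<Rightarrow> 'b :: {real_normed_field, banach}"
  assumes "finite P" "g summable_on U" "\<And>p. p \<in> P \<Longrightarrow> A p \<subseteq> U"
  shows "(\<Sum>p\<in>P. infsum g (A p)) = infsum (\<lambda>x. of_nat (card {p \<in> P. x \<in> A p}) * g x) U"
proof -
  have "(\<lambda>x. \<Sum>p\<in>P. if x \<in> A p then g x else 0) summable_on U \<and>
      infsum (\<lambda>x. \<Sum>p\<in>P. if x \<in> A p then g x else 0) U = (\<Sum>p\<in>P. infsum g (A p))"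
    using assms(1,3)
  proof (induction P rule: finite_induct)
    case (insert p P)
    have "(\<lambda>x. if x \<in> A p then g x else 0) summable_on U \<longleftrightarrow> g summable_on A p"
      using insert.prems by (intro summable_on_cong_neutral) auto
    then have "(\<lambda>x. if x \<in> A p then g x else 0) summable_on U"
      using insert.prems assms(2) summable_on_subset_banach by blast
    moreover have "infsum (\<lambda>x. if x \<in> A p then g x else 0) U = infsum g (A p)"
      using insert.prems by (intro infsum_cong_neutral) auto
    ultimately show ?case
      using insert by (auto intro: summable_on_add simp: infsum_add)
  qed simp
  moreover have "(\<Sum>p\<in>P. if x \<in> A p then g x else 0) = of_nat (card {p \<in> P. x \<in> A p}) * g x" for x
    using assms(1) by (simp add: sum.If_cases Int_def)
  ultimately show ?thesis by simp
qed

text \<open>A finite sum of series over sets depends only on how often each point is covered.  Summability over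
  the sets \<open>B i\<close> follows from that over the \<open>A p\<close>, because equal multiplicities force every \<open>B i\<close> into the
  finite union of the \<open>A p\<close>.\<close>
lemma sum_infsum_eq_by_multiplicity:
  fixes g :: "'a \<Rightarrow> 'b :: {real_normed_field, banach}"
  assumes "finite P" "finite I" "\<And>p. p \<in> P \<Longrightarrow> g summable_on A p"
    and card: "\<And>x. card {p \<in> P. x \<in> A p} = card {i \<in> I. x \<in> B i}"
  shows "(\<Sum>p\<in>P. infsum g (A p)) = (\<Sum>i\<in>I. infsum g (B i))"
proof -
  let ?U = "\<Union>p\<in>P. A p"
  have "B i \<subseteq> ?U" if "i \<in> I" for i
  proof
    fix x assume "x \<in> B i"
    then have "card {i \<in> I. x \<in> B i} \<noteq> 0" using that assms(2) by auto
    then have "{p \<in> P. x \<in> A p} \<noteq> {}" unfolding card[symmetric] by force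
    then show "x \<in> ?U" by auto
  qed
  then show ?thesis
    using sum_infsum_eq_infsum_multiplicity[of P g ?U A] sum_infsum_eq_infsum_multiplicity[of I g ?U B]
      summable_on_finite_UN[OF assms(1,3)] assms(1,2) card by auto
qed

section \<open>Tableaux as sequences of strips\<close>

text \<open>A tableau is stored as the sequence \<open>C\<close> of its strips, each a list of letters from the first line
  on.  The flag \<open>T\<close> tells whether strips are rows (\<open>True\<close>) or columns (\<open>False\<close>).  Boxes are numbered
  from one, strips and list positions from zero.\<close>
definition cells :: "bool \<Rightarrow> (nat \<Rightarrow> 'a list) \<Rightarrow> (nat \<times> nat) set" where
  "cells T C = {(i, j). 1 \<le> i \<and> 1 \<le> j \<and>
     (if T then j \<le> length (C (i - 1)) else i \<le> length (C (j - 1)))}"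

definition tab :: "bool \<Rightarrow> (nat \<Rightarrow> 'a list) \<Rightarrow> nat \<times> nat \<Rightarrow> 'a" where
  "tab T C = restrict (\<lambda>(i, j). if T then C (i - 1) ! (j - 1) else C (j - 1) ! (i - 1)) (cells T C)"

definition stacked :: "(nat \<Rightarrow> 'a list) \<Rightarrow> bool" where
  "stacked C \<longleftrightarrow> (\<forall>j. length (C (Suc j)) \<le> length (C j)) \<and> (\<exists>n. C n = [])"

text \<open>Two long lines \<open>r\<close> and \<open>r'\<close>, with the strip at position zero continued by \<open>xi\<close>.  Hooks, their pushed
  forms and (with empty \<open>r'\<close> and \<open>xi\<close>) single lines are all of this kind.\<close>
definition two_row :: "'a list \<Rightarrow> 'a list \<Rightarrow> 'a list \<Rightarrow> nat \<Rightarrow> 'a list" where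
  "two_row r r' xi j = (if j < length r then [r ! j] else []) @
     (if j < length r' then [r' ! j] else []) @ (if j = 0 then xi else [])"

lemma stacked_antimono:
  assumes "stacked C" "i \<le> j"
  shows "length (C j) \<le> length (C i)"
  using lift_Suc_antimono_le[of "\<lambda>j. length (C j)" i j] assms by (simp add: stacked_def)

lemma young_cells:
  assumes "stacked C"
  shows "young (cells T C)"
proof -
  obtain n where n: "C n = []" using assms by (auto simp: stacked_def)
  have empty: "length (C j) = 0 \<or> j < n" for j
    using stacked_antimono[OF assms, of n j] n by (cases "n \<le> j") auto
  have "cells T C \<subseteq> {1..n + length (C 0)} \<times> {1..n + length (C 0)}"
  proof clarify
    fix i j assume b: "(i, j) \<in> cells T C"
    show "i \<in> {1..n + length (C 0)} \<and> j \<in> {1..n + length (C 0)}"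
      using b empty[of "i - 1"] empty[of "j - 1"]
        stacked_antimono[OF assms, of 0 "i - 1"] stacked_antimono[OF assms, of 0 "j - 1"]
      by (auto simp: cells_def split: if_splits)
  qed
  then have "finite (cells T C)" by (rule finite_subset) simp
  moreover have "(i', j') \<in> cells T C"
    if "(i, j) \<in> cells T C" "1 \<le> i'" "i' \<le> i" "1 \<le> j'" "j' \<le> j" for i j i' j'
    using that stacked_antimono[OF assms diff_le_mono[OF that(3), of 1]]
      stacked_antimono[OF assms diff_le_mono[OF that(5), of 1]]
    by (auto simp: cells_def split: if_splits)
  ultimately show ?thesis by (auto simp: young_def) (auto simp: cells_def)
qed

text \<open>The hypothesis on \<open>n\<close> provides finiteness: with weakly decreasing lengths, one empty strip makes all
  later ones empty.\<close>
lemma young_cells_iff: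
  assumes "\<exists>n. C n = []"
  shows "young (cells T C) \<longleftrightarrow> stacked C"
proof
  assume Y: "young (cells T C)"
  have "length (C (Suc j)) \<le> length (C j)" for j
  proof (cases "C (Suc j)")
    case Cons
    then have "(if T then (Suc (Suc j), length (C (Suc j))) else (length (C (Suc j)), Suc (Suc j))) \<in> cells T C"
      by (auto simp: cells_def)
    moreover have "1 \<le> length (C (Suc j))" using Cons by simp
    ultimately have "(if T then (Suc j, length (C (Suc j))) else (length (C (Suc j)), Suc j)) \<in> cells T C"
      using youngD[OF Y, of "Suc (Suc j)" "length (C (Suc j))" "Suc j" "length (C (Suc j))"]
        youngD[OF Y, of "length (C (Suc j))" "Suc (Suc j)" "length (C (Suc j))" "Suc j"]
      by (auto split: if_splits)
    then show ?thesis by (auto simp: cells_def split: if_splits)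
  qed simp
  then show "stacked C" using assms by (simp add: stacked_def)
qed (rule young_cells)

text \<open>The order relation along lines, pulled back to letters.  Both axioms hold for \<open>f u \<le> f v\<close> and for
  \<open>f u < f v\<close>; the second one makes the negated converse transitive as well.\<close>
locale strip_order =
  fixes R :: "'a \<Rightarrow> 'a \<Rightarrow> bool"
  assumes trans: "R u v \<Longrightarrow> R v w \<Longrightarrow> R u w"
    and cotrans: "R u w \<Longrightarrow> R u v \<or> R v w"
begin

lemma transp_not_converse: "transp (\<lambda>u v. \<not> R v u)"
  by (rule transpI) (metis cotrans)

end

text \<open>Along a strip the relation is the negated converse of \<open>R\<close>, which is \<open><\<close> if \<open>R\<close> is \<open>\<le>\<close> and vice versa.\<close>
definition semistandard :: "('a \<Rightarrow> 'a \<Rightarrow> bool) \<Rightarrow> (nat \<Rightarrow> 'a list) \<Rightarrow> bool" where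
  "semistandard R C \<longleftrightarrow> (\<forall>j. sorted_wrt (\<lambda>u v. \<not> R v u) (C j)) \<and>
     (\<forall>j j' i. j < j' \<and> i < length (C j) \<and> i < length (C j') \<longrightarrow> R (C j ! i) (C j' ! i))"

definition along :: "bool \<Rightarrow> nat \<Rightarrow> nat \<Rightarrow> bool" where
  "along T = (if T then (<) else (\<le>))"

lemma strip_order_along: "strip_order (\<lambda>u v. along T (f u) (f v))"
  by unfold_locales (auto simp: along_def split: if_splits)

text \<open>This is where rows and columns are exchanged: for strips that are columns, lines are rows and
  increase weakly, while for strips that are rows, lines are columns and increase strictly.\<close>
lemma SSYT_iff_semistandard:
  assumes D: "diagram mu = cells T C" and f: "f \<in> V \<rightarrow>\<^sub>E {1..}" and V: "\<And>j. set (C j) \<subseteq> V"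
  shows "restrict (f \<circ> tab T C) (diagram mu) \<in> SSYT mu \<longleftrightarrow> semistandard (\<lambda>u v. along T (f u) (f v)) C"
proof -
  let ?M = "restrict (f \<circ> tab T C) (diagram mu)"
  have in_tab: "?M \<in> tableaux mu {1..}"
  proof -
    have "f (tab T C b) \<in> {1..}" if "b \<in> cells T C" for b
    proof (intro PiE_mem[OF f])
      obtain i j where "b = (i, j)" by fastforce
      with that show "tab T C b \<in> V"
        using V[of "i - 1"] V[of "j - 1"]
        by (auto simp: tab_def cells_def subset_eq split: if_splits)
    qed
    then show ?thesis unfolding tableaux_def D restrict_PiE_iff by simp
  qed
  define box where "box j i = (if T then (Suc j, Suc i) else (Suc i, Suc j))" for j i
  have box: "box j i \<in> cells T C \<longleftrightarrow> i < length (C j)" for j i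
    by (auto simp: box_def cells_def)
  have M: "?M (box j i) = f (C j ! i)" if "i < length (C j)" for j i
    using that box[of j i] D by (simp add: tab_def) (simp add: box_def)
  have pos: "\<exists>j i. b = box j i" if "b \<in> cells T C" for b
  proof -
    obtain i j where "b = (Suc i, Suc j)"
      using \<open>b \<in> cells T C\<close> by (cases b) (auto simp: cells_def Suc_le_eq gr0_conv_Suc)
    then have "b = (if T then box i j else box j i)" by (simp add: box_def)
    then show ?thesis by metis
  qed
  have "?M \<in> SSYT mu \<longleftrightarrow>
      (\<forall>i j j'. (i, j) \<in> cells T C \<and> (i, j') \<in> cells T C \<and> j < j' \<longrightarrow> ?M (i, j) \<le> ?M (i, j')) \<and>
      (\<forall>i i' j. (i, j) \<in> cells T C \<and> (i', j) \<in> cells T C \<and> i < i' \<longrightarrow> ?M (i, j) < ?M (i', j))"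
    using in_tab by (simp add: SSYT_def D)
  also have "\<dots> \<longleftrightarrow>
      (\<forall>j i i'. i < i' \<and> i' < length (C j) \<longrightarrow> \<not> along T (f (C j ! i')) (f (C j ! i))) \<and>
      (\<forall>j j' i. j < j' \<and> i < length (C j) \<and> i < length (C j') \<longrightarrow> along T (f (C j ! i)) (f (C j' ! i)))"
    (is "?S \<longleftrightarrow> ?K")
  proof
    assume S: ?S
    show ?K
    proof (intro conjI allI impI)
      fix j i i' assume "i < i' \<and> i' < length (C j)"
      then show "\<not> along T (f (C j ! i')) (f (C j ! i))"
        using S box[of j i] box[of j i'] M[of i j] M[of i' j]
        by (cases T) (force simp: box_def along_def not_less not_le)+
    next
      fix j j' i assume "j < j' \<and> i < length (C j) \<and> i < length (C j')"
      then show "along T (f (C j ! i)) (f (C j' ! i))"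
        using S box[of j i] box[of j' i] M[of i j] M[of i j']
        by (cases T) (force simp: box_def along_def)+
    qed
  next
    assume K: ?K
    show ?S
    proof (intro conjI allI impI)
      fix i j j' assume *: "(i, j) \<in> cells T C \<and> (i, j') \<in> cells T C \<and> j < j'"
      then obtain a b a' b' where "(i, j) = box a b" "(i, j') = box a' b'" using pos by metis
      then show "?M (i, j) \<le> ?M (i, j')"
        using * K M[of b a] M[of b' a'] box[of a b] box[of a' b']
        by (cases T) (auto simp: box_def along_def not_less)
    next
      fix i i' j assume *: "(i, j) \<in> cells T C \<and> (i', j) \<in> cells T C \<and> i < i'"
      then obtain a b a' b' where "(i, j) = box a b" "(i', j) = box a' b'" using pos by metis
      then show "?M (i, j) < ?M (i', j)"
        using * K M[of b a] M[of b' a'] box[of a b] box[of a' b']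
        by (cases T) (auto simp: box_def along_def not_le)
    qed
  qed
  also have "\<dots> \<longleftrightarrow> semistandard (\<lambda>u v. along T (f u) (f v)) C"
    unfolding semistandard_def sorted_wrt_iff_nth_less by blast
  finally show ?thesis .
qed

lemma semistandard_cong:
  assumes "\<And>u v j j'. u \<in> set (C j) \<Longrightarrow> v \<in> set (C j') \<Longrightarrow> R u v = R' u v"
  shows "semistandard R C = semistandard R' C"
proof -
  have "sorted_wrt (\<lambda>u v. \<not> R v u) (C j) = sorted_wrt (\<lambda>u v. \<not> R' v u) (C j)" for j
    using assms by (auto intro: sorted_wrt_mono_rel[rotated])
  then show ?thesis unfolding semistandard_def using assms by (metis nth_mem)
qed

lemma semistandard_map: "semistandard (\<lambda>u v. R (p u) (p v)) C = semistandard R (\<lambda>j. map p (C j))"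
  by (auto simp: semistandard_def sorted_wrt_map)

lemma map_two_row: "(\<lambda>j. map p (two_row r r' xi j)) = two_row (map p r) (map p r') (map p xi)"
  by (auto simp: two_row_def)

definition fills :: "'a set \<Rightarrow> (nat \<Rightarrow> 'a list) \<Rightarrow> bool" where
  "fills V C \<longleftrightarrow> (\<forall>j. distinct (C j)) \<and> (\<forall>j j'. j \<noteq> j' \<longrightarrow> set (C j) \<inter> set (C j') = {}) \<and>
     (\<Union>j. set (C j)) = V"

lemma fills_push:
  assumes "fills V C" "a \<notin> V"
  shows "fills (insert a V) (C(j := a # C j))"
  using assms unfolding fills_def
  by (auto split: if_splits)

lemma bij_tab:
  assumes "fills V C"
  shows "bij_betw (tab T C) (cells T C) V"
proof -
  define box where "box z = (if T then (Suc (fst z), Suc (snd z)) else (Suc (snd z), Suc (fst z)))"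
    for z :: "nat \<times> nat"
  let ?I = "SIGMA j:UNIV. {..<length (C j)}"
  have "inj box" by (auto simp: inj_on_def box_def prod_eq_iff split: if_splits)
  moreover have "box ` ?I = cells T C"
  proof (intro equalityI subsetI)
    fix b assume "b \<in> cells T C"
    then show "b \<in> box ` ?I"
      by (intro image_eqI[of _ _ "if T then (fst b - 1, snd b - 1) else (snd b - 1, fst b - 1)"])
        (auto simp: box_def cells_def split: if_splits)
  qed (auto simp: box_def cells_def)
  ultimately have box: "bij_betw box ?I (cells T C)" by (simp add: bij_betw_def inj_on_subset[of box UNIV])
  have "bij_betw (\<lambda>(j, i). C j ! i) ?I V"
  proof (rule bij_betw_imageI)
    show "inj_on (\<lambda>(j, i). C j ! i) ?I"
    proof (rule inj_onI, clarsimp)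
      fix j i j' i' assume *: "i < length (C j)" "i' < length (C j')" "C j ! i = C j' ! i'"
      then have "j = j'" using assms unfolding fills_def by (metis disjoint_iff nth_mem)
      with * show "j = j' \<and> i = i'" using assms unfolding fills_def by (metis nth_eq_iff_index_eq)
    qed
    show "(\<lambda>(j, i). C j ! i) ` ?I = V"
      using assms unfolding fills_def by (force simp: in_set_conv_nth image_iff)
  qed
  moreover have "bij_betw (tab T C \<circ> box) ?I V \<longleftrightarrow> bij_betw (\<lambda>(j, i). C j ! i) ?I V"
    by (rule bij_betw_cong) (auto simp: tab_def box_def cells_def)
  ultimately have "bij_betw (tab T C \<circ> box) ?I V" by simp
  then show ?thesis using bij_betw_comp_iff[OF box] by blast
qed

lemma two_row_hook:
  "ys \<noteq> [] \<Longrightarrow> two_row ys [x] xs =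
    (\<lambda>j. if j = 0 then hd ys # x # xs else if j < length ys then [ys ! j] else [])"
  by (auto simp: two_row_def hd_conv_nth)

lemma fills_two_row_hook:
  assumes "distinct (ys @ x # xs)" "ys \<noteq> []"
  shows "fills (set (ys @ x # xs)) (two_row ys [x] xs)"
proof -
  obtain y ys' where ys: "ys = y # ys'" using assms by (cases ys) auto
  have C0: "two_row ys [x] xs 0 = y # x # xs"
    and CS: "two_row ys [x] xs (Suc j) = (if j < length ys' then [ys' ! j] else [])" for j
    by (simp_all add: two_row_def ys)
  have "distinct (two_row ys [x] xs j)" for j
    using assms(1)[unfolded ys] by (cases j) (simp_all add: C0 CS)
  moreover have "set (two_row ys [x] xs j) \<inter> set (two_row ys [x] xs j') = {}" if "j \<noteq> j'" for j j'
  proof -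
    have "set (two_row ys [x] xs (Suc i)) \<subseteq> set ys'" for i by (auto simp: CS)
    moreover have "set (two_row ys [x] xs 0) \<inter> set ys' = {}" using assms(1)[unfolded ys] by (auto simp: C0)
    moreover have "set (two_row ys [x] xs (Suc i)) \<inter> set (two_row ys [x] xs (Suc i')) = {}"
      if "i \<noteq> i'" for i i'
      using that assms(1)[unfolded ys] by (auto simp: CS nth_eq_iff_index_eq)
    ultimately show ?thesis using that by (cases j; cases j') blast+
  qed
  moreover have "(\<Union>j. set (two_row ys [x] xs j)) = set (ys @ x # xs)"
  proof -
    have "(\<Union>j. set (two_row ys [x] xs j)) =
        set (two_row ys [x] xs 0) \<union> (\<Union>j. set (two_row ys [x] xs (Suc j)))"
      by (subst UNIV_nat_eq) simp
    also have "(\<Union>j. set (two_row ys [x] xs (Suc j))) = set ys'"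
      by (auto simp: CS in_set_conv_nth split: if_splits)
    finally show ?thesis unfolding C0 by (auto simp: ys)
  qed
  ultimately show ?thesis by (auto simp: fills_def)
qed

lemma fills_two_row_single:
  assumes "distinct zs"
  shows "fills (set zs) (two_row zs [] [])"
  using assms by (auto simp: fills_def two_row_def nth_eq_iff_index_eq in_set_conv_nth split: if_splits)

lemma stacked_hook:
  assumes "ys \<noteq> []"
  shows "stacked (two_row ys [x] xs)"
proof -
  have "two_row ys [x] xs (length ys) = []" using assms by (simp add: two_row_def)
  then show ?thesis unfolding stacked_def by (auto simp: two_row_def split: if_splits)
qed

lemma schur_mzv_strips:
  assumes C: "fills V C" and D: "diagram mu = cells T C"
  shows "schur_mzv mu (subst_tab mu w (tab T C)) =
      infsum (weight V w) {f \<in> V \<rightarrow>\<^sub>E {1..}. semistandard (\<lambda>u v. along T (f u) (f v)) C}"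
    and "subst_tab mu w (tab T C) \<in> W mu \<Longrightarrow>
      weight V w summable_on {f \<in> V \<rightarrow>\<^sub>E {1..}. semistandard (\<lambda>u v. along T (f u) (f v)) C}"
proof -
  have bij: "bij_betw (tab T C) (diagram mu) V" using bij_tab[OF C] D by simp
  have V: "set (C j) \<subseteq> V" for j using C by (auto simp: fills_def)
  have eq: "{f \<in> V \<rightarrow>\<^sub>E {1..}. restrict (f \<circ> tab T C) (diagram mu) \<in> SSYT mu} =
      {f \<in> V \<rightarrow>\<^sub>E {1..}. semistandard (\<lambda>u v. along T (f u) (f v)) C}"
    using SSYT_iff_semistandard[OF D _ V] by blast
  show "schur_mzv mu (subst_tab mu w (tab T C)) =
      infsum (weight V w) {f \<in> V \<rightarrow>\<^sub>E {1..}. semistandard (\<lambda>u v. along T (f u) (f v)) C}"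
    "subst_tab mu w (tab T C) \<in> W mu \<Longrightarrow>
      weight V w summable_on {f \<in> V \<rightarrow>\<^sub>E {1..}. semistandard (\<lambda>u v. along T (f u) (f v)) C}"
    using schur_mzv_letters[OF bij] unfolding eq by blast+
qed

section \<open>The pushing rule on strips\<close>

text \<open>The pushing rule on strips, where putting a letter in front of a strip is a list \<open>Cons\<close>.  The strip at
  position \<open>j\<close> may be pushed if it is the first one or shorter than its predecessor; an empty strip stands for the place
  at the end of the first line.  The argument \<open>c\<close> is the first strip that is still allowed.\<close>
primrec pushes :: "'a list \<Rightarrow> nat \<Rightarrow> (nat \<Rightarrow> 'a list) \<Rightarrow> (nat \<Rightarrow> 'a list) set" where
  "pushes [] c C = {C}"
| "pushes (a # ts) c C =
     (\<Union>j\<in>{j. c \<le> j \<and> (j = 0 \<or> length (C j) < length (C (j - 1)))}.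
        pushes ts (Suc j) (C(j := a # C j)))"

lemma push_down_cells:
  "push_down_diagram (Suc j) (cells False C) = cells False (C(j := a # C j))"
  "push_down (Suc j) a (cells False C) (tab False C) = tab False (C(j := a # C j))"
proof -
  show D: "push_down_diagram (Suc j) (cells False C) = cells False (C(j := a # C j))"
    by (auto simp: push_down_diagram_def cells_def image_iff split: if_splits)
      (metis Suc_diff_1 Suc_le_mono not_gr0 One_nat_def Suc_le_eq)+
  show "push_down (Suc j) a (cells False C) (tab False C) = tab False (C(j := a # C j))"
    unfolding push_down_def D
    by (auto simp: tab_def cells_def fun_eq_iff restrict_def nth_Cons' split: if_splits)
qed

lemma push_right_cells:
  "push_right_diagram (Suc j) (cells True C) = cells True (C(j := a # C j))"
  "push_right (Suc j) a (cells True C) (tab True C) = tab True (C(j := a # C j))"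
proof -
  show D: "push_right_diagram (Suc j) (cells True C) = cells True (C(j := a # C j))"
    by (auto simp: push_right_diagram_def cells_def image_iff split: if_splits)
      (metis Suc_diff_1 Suc_le_mono not_gr0 One_nat_def Suc_le_eq)+
  show "push_right (Suc j) a (cells True C) (tab True C) = tab True (C(j := a # C j))"
    unfolding push_right_def D
    by (auto simp: tab_def cells_def fun_eq_iff restrict_def nth_Cons' split: if_splits)
qed

lemma stacked_push:
  assumes "stacked C"
  shows "stacked (C(j := a # C j)) \<longleftrightarrow> j = 0 \<or> length (C j) < length (C (j - 1))"
proof
  assume "stacked (C(j := a # C j))"
  from stacked_antimono[OF this, of "j - 1" j]
  show "j = 0 \<or> length (C j) < length (C (j - 1))" by (auto split: if_splits)
next
  assume j: "j = 0 \<or> length (C j) < length (C (j - 1))"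
  obtain n where "C n = []" using assms by (auto simp: stacked_def)
  then have "C (n + Suc j) = []"
    using stacked_antimono[OF assms, of n "n + Suc j"] by simp
  then have "(C(j := a # C j)) (n + Suc j) = []" by simp
  moreover have "length ((C(j := a # C j)) (Suc i)) \<le> length ((C(j := a # C j)) i)" for i
    using assms j by (auto simp: stacked_def le_Suc_eq)
  ultimately show "stacked (C(j := a # C j))" unfolding stacked_def by blast
qed

lemma stacked_pushes:
  assumes "C' \<in> pushes ts c C" "stacked C"
  shows "stacked C'"
  using assms
proof (induction ts arbitrary: c C)
  case (Cons a ts)
  then show ?case using stacked_push by fastforce
qed simp

lemma young_push:
  assumes "stacked C"
  shows "young (cells T (C(j := a # C j))) \<longleftrightarrow> j = 0 \<or> length (C j) < length (C (j - 1))"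
proof -
  obtain n where "C n = []" using assms by (auto simp: stacked_def)
  then have "C (n + Suc j) = []"
    using stacked_antimono[OF assms, of n "n + Suc j"] by simp
  then have "(C(j := a # C j)) (n + Suc j) = []" by simp
  then have "\<exists>n. (C(j := a # C j)) n = []" by blast
  then show ?thesis using young_cells_iff stacked_push[OF assms] by metis
qed

lemma strip_nonempty_iff:
  assumes "is_partition lam" "lam \<noteq> []" "diagram lam = cells T C"
  shows "C j \<noteq> [] \<longleftrightarrow> Suc j \<le> (if T then length lam else hd lam)"
proof -
  have "C j \<noteq> [] \<longleftrightarrow> (if T then (Suc j, 1) else (1, Suc j)) \<in> diagram lam"
    unfolding assms(3) by (auto simp: cells_def Suc_le_eq)
  also have "\<dots> \<longleftrightarrow> Suc j \<le> (if T then length lam else hd lam)"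
    using assms(1,2) by (auto simp: diagram_def is_partition_def hd_conv_nth Suc_le_eq)
  finally show ?thesis .
qed

lemma UN_shift: "(\<Union>j\<in>{c<..n + 1}. F j) = (\<Union>j\<in>{j. c \<le> j \<and> j \<le> n}. F (Suc j))" for n :: nat
proof -
  have "{c<..n + 1} = Suc ` {j. c \<le> j \<and> j \<le> n}"
    by (auto simp: image_iff) presburger
  then show ?thesis by simp
qed

text \<open>The upper bound on the position of the insertion is implied by the shape condition, as a strip beyond
  the first empty one has no nonempty predecessor.\<close>
lemma push_indices:
  assumes "is_partition lam" "lam \<noteq> []" "diagram lam = cells T C" "stacked C"
  shows "(\<Union>j\<in>{j. c \<le> j \<and> j \<le> (if T then length lam else hd lam)}.
      \<Union>mu\<in>{mu. is_partition mu \<and> diagram mu = cells T (C(j := a # C j))}. F j mu) =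
    (\<Union>j\<in>{j. c \<le> j \<and> (j = 0 \<or> length (C j) < length (C (j - 1)))}.
      F j (shape (cells T (C(j := a # C j)))))"
proof -
  have "j \<le> (if T then length lam else hd lam)" if "j = 0 \<or> length (C j) < length (C (j - 1))" for j
    using that strip_nonempty_iff[OF assms(1-3), of "j - 1"] by (cases j) auto
  then show ?thesis
    unfolding partitions_with_diagram young_push[OF assms(4)]
    by (auto split: if_splits)
qed

lemma shape_cells_nonempty:
  assumes "young (cells T (C(j := a # C j)))"
  shows "shape (cells T (C(j := a # C j))) \<noteq> []"
proof
  assume "shape (cells T (C(j := a # C j))) = []"
  then have "cells T (C(j := a # C j)) = diagram []" using shape(2)[OF assms] by simp
  moreover have "(if T then (Suc j, 1) else (1, Suc j)) \<in> cells T (C(j := a # C j))"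
    by (auto simp: cells_def)
  ultimately show False by (simp add: diagram_def split: if_splits)
qed

lemma push_shape:
  assumes "stacked C" "j = 0 \<or> length (C j) < length (C (j - 1))"
  shows "is_partition (shape (cells T (C(j := a # C j))))" "shape (cells T (C(j := a # C j))) \<noteq> []"
    "diagram (shape (cells T (C(j := a # C j)))) = cells T (C(j := a # C j))"
    "stacked (C(j := a # C j))"
  using assms by (simp_all add: young_push shape stacked_push shape_cells_nonempty)

lemma row_insertions_eq:
  assumes "is_partition lam" "lam \<noteq> []" "diagram lam = cells False C" "stacked C"
  shows "row_insertions ts c lam (tab False C) =
    (\<lambda>C'. (shape (cells False C'), tab False C')) ` pushes ts c C"
  using assms
proof (induction ts arbitrary: c lam C)
  case Nil
  then show ?case using shape_diagram[of lam] by simp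
next
  case (Cons a ts)
  show ?case
    unfolding row_insertions.simps pushes.simps UN_shift Cons.prems(3) push_down_cells[where a = a]
      push_indices[OF Cons.prems, simplified if_False] image_UN
    using Cons.prems(4) by (intro SUP_cong refl Cons.IH push_shape) auto
qed

lemma col_insertions_eq:
  assumes "is_partition lam" "lam \<noteq> []" "diagram lam = cells True C" "stacked C"
  shows "col_insertions ts c lam (tab True C) =
    (\<lambda>C'. (shape (cells True C'), tab True C')) ` pushes ts c C"
  using assms
proof (induction ts arbitrary: c lam C)
  case Nil
  then show ?case using shape_diagram[of lam] by simp
next
  case (Cons a ts)
  show ?case
    unfolding col_insertions.simps pushes.simps UN_shift Cons.prems(3) push_right_cells[where a = a]
      push_indices[OF Cons.prems, simplified if_True] image_UN
    using Cons.prems(4) by (intro SUP_cong refl Cons.IH push_shape) auto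
qed

text \<open>Hence a sum over the set of pushed tableaux is a sum over the sequences of strips.\<close>
lemma inj_shape_tab: "inj_on (\<lambda>C. (shape (cells T C), tab T C)) {C. stacked C}"
proof (rule inj_onI)
  fix C C' :: "nat \<Rightarrow> 'a list"
  assume C: "C \<in> {C. stacked C}" "C' \<in> {C. stacked C}"
    and eq: "(shape (cells T C), tab T C) = (shape (cells T C'), tab T C')"
  then have cells: "cells T C = cells T C'"
    using shape(2)[OF young_cells] by (metis mem_Collect_eq prod.inject)
  define pos where "pos j i = (if T then (Suc j, Suc i) else (Suc i, Suc j))" for i j
  have pos: "pos j i \<in> cells T C \<longleftrightarrow> i < length (C j)" for i j and C :: "nat \<Rightarrow> 'a list"
    by (auto simp: pos_def cells_def)
  have tab: "tab T C (pos j i) = C j ! i" if "i < length (C j)" for i j and C :: "nat \<Rightarrow> 'a list"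
    using that pos[of j i C] by (auto simp: tab_def) (auto simp: pos_def)
  show "C = C'"
  proof
    fix j
    have "i < length (C j) \<longleftrightarrow> i < length (C' j)" for i using pos cells by metis
    then have "length (C j) = length (C' j)" by (metis linorder_neqE_nat less_irrefl)
    then show "C j = C' j"
      using tab[of _ C j] tab[of _ C' j] eq by (simp add: list_eq_iff_nth_eq)
  qed
qed

lemma fills_pushes:
  assumes "fills V C" "distinct ts" "set ts \<inter> V = {}" "C' \<in> pushes ts c C"
  shows "fills (V \<union> set ts) C'"
  using assms
proof (induction ts arbitrary: V c C)
  case (Cons a ts)
  then obtain j where j: "C' \<in> pushes ts (Suc j) (C(j := a # C j))" by auto
  have fills: "fills (insert a V) (C(j := a # C j))"
    using Cons.prems by (intro fills_push) auto
  have "fills (insert a V \<union> set ts) C'"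
    by (rule Cons.IH[OF fills _ _ j]) (use Cons.prems(2,3) in auto)
  then show ?case by simp
qed simp

text \<open>After a letter has been placed at the end of the first line, all later letters must follow it there.\<close>
lemma pushes_right:
  assumes "r \<noteq> []" "length r' \<le> length r"
  shows "pushes ts (length r) (two_row r r' xi) = {two_row (r @ ts) r' xi}"
  using assms
proof (induction ts arbitrary: r)
  case (Cons a ts)
  let ?C = "two_row r r' xi"
  have "{j. length r \<le> j \<and> (j = 0 \<or> length (?C j) < length (?C (j - 1)))} = {length r}"
    using Cons.prems
    by (auto simp: two_row_def simp flip: length_greater_0_conv split: if_splits)
  moreover have "?C(length r := a # ?C (length r)) = two_row (r @ [a]) r' xi"
    using Cons.prems by (auto simp: two_row_def nth_append)
  ultimately show ?case using Cons.IH[of "r @ [a]"] Cons.prems by simp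
qed auto

text \<open>At the moment when the first \<open>length r\<close> strips have been dealt with, the next letter either goes on top of
  the next strip, whose predecessor has length at least two, or to the end of the first line.  Any
  strip in between has a predecessor of length one and cannot be pushed.  The parameter \<open>p\<close> is the number
  of further strips that are pushed.\<close>
lemma pushes_two_row:
  assumes "r \<noteq> []" "length r' = length r"
  shows "pushes ts (length r) (two_row (r @ us) r' xi) =
    (\<lambda>p. two_row (r @ take p ts @ drop p us @ drop p ts) (r' @ take p us) xi) `
      {..min (length us) (length ts)}"
  using assms
proof (induction ts arbitrary: r us r')
  case (Cons a ts)
  show ?case
  proof (cases us)
    case Nil
    then show ?thesis using pushes_right[of r r' "a # ts" xi] Cons.prems by simp
  next
    case (Cons u us')
    let ?C = "two_row (r @ us) r' xi"
    have j: "{j. length r \<le> j \<and> (j = 0 \<or> length (?C j) < length (?C (j - 1)))} =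
        {length r, length (r @ us)}"
      using Cons.prems Cons
      by (auto simp: two_row_def simp flip: length_greater_0_conv split: if_splits)
    have C1: "?C(length r := a # ?C (length r)) = two_row ((r @ [a]) @ us') (r' @ [u]) xi"
      using Cons.prems Cons
      by (auto simp: two_row_def nth_append fun_eq_iff nth_Cons split: nat.splits)
    have C2: "?C(length (r @ us) := a # ?C (length (r @ us))) = two_row (r @ us @ [a]) r' xi"
      using Cons.prems
      by (auto simp: two_row_def nth_append fun_eq_iff)
    have P1: "pushes ts (Suc (length r)) (two_row ((r @ [a]) @ us') (r' @ [u]) xi) =
        (\<lambda>p. two_row (r @ take p (a # ts) @ drop p us @ drop p (a # ts)) (r' @ take p us) xi) `
          Suc ` {..min (length us') (length ts)}"
      using Cons.IH[of "r @ [a]" "r' @ [u]" us'] Cons.prems Cons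
      by (simp add: image_image)
    have P2: "pushes ts (Suc (length (r @ us))) (two_row (r @ us @ [a]) r' xi) =
        {two_row (r @ us @ a # ts) r' xi}"
      using pushes_right[of "r @ us @ [a]" r' ts xi] Cons.prems by simp
    have ind: "{..min (length us) (length (a # ts))} = insert 0 (Suc ` {..min (length us') (length ts)})"
      using Cons by (simp add: atMost_Suc_eq_insert_0)
    show ?thesis
      unfolding pushes.simps j ind image_insert UN_insert C1 C2 P1 P2 by auto
  qed
qed simp

text \<open>The two families differ in whether the first strip is pushed.\<close>
lemma pushes_hook:
  assumes "length ys = l" "length zs = m" "0 < l" "0 < m"
  shows "pushes zs 0 (two_row ys [x] xs) =
    (\<lambda>p. two_row (hd ys # take p zs @ drop (Suc p) ys @ drop p zs) (x # take p (tl ys)) xs) `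
      {..min (l - 1) m} \<union>
    (\<lambda>p. two_row (take (Suc p) zs @ drop (Suc p) ys @ drop (Suc p) zs) (take (Suc p) ys) (x # xs)) `
      {..min (l - 1) (m - 1)}"
proof -
  obtain y ys' where ys: "ys = y # ys'" using assms by (cases ys) auto
  obtain z zs' where zs: "zs = z # zs'" using assms by (cases zs) auto
  let ?C = "two_row ys [x] xs"
  have C: "?C(0 := z # ?C 0) = two_row ([z] @ ys') [y] (x # xs)"
    by (auto simp: two_row_def fun_eq_iff ys)
  have "{j. 0 \<le> j \<and> (j = 0 \<or> length (?C j) < length (?C (j - 1)))} =
      insert 0 {j. 1 \<le> j \<and> (j = 0 \<or> length (?C j) < length (?C (j - 1)))}"
    by auto
  then have "pushes zs 0 ?C = pushes zs' 1 (two_row ([z] @ ys') [y] (x # xs)) \<union> pushes zs 1 ?C"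
    unfolding zs pushes.simps by (simp add: C del: One_nat_def) simp
  moreover have "pushes zs 1 ?C = pushes zs (length [y]) (two_row ([y] @ ys') [x] xs)"
    by (simp add: ys)
  ultimately show ?thesis
    using pushes_two_row[of "[y]" "[x]" zs ys' xs] pushes_two_row[of "[z]" "[y]" zs' ys' "x # xs"]
    assms(1,2)[symmetric]
    by (simp add: ys zs Un_commute)
qed

lemma two_row_length_cong:
  assumes "two_row r r' xi = two_row s s' xi" "r' \<noteq> []" "s' \<noteq> []"
    "length r' \<le> length r" "length s' \<le> length s"
  shows "length r' = length s'"
proof -
  have le: "length s' \<le> length r'"
    if "two_row r r' xi = two_row s s' xi" "r' \<noteq> []" "length s' \<le> length s" for r r' s s' :: "'a list"
  proof (rule ccontr)
    assume "\<not> length s' \<le> length r'"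
    then have "length (two_row s s' xi (length r')) = 2" "length (two_row r r' xi (length r')) \<le> 1"
      using that(2,3) by (auto simp: two_row_def)
    then show False using that(1) by (metis Suc_1 not_less_eq_eq order_refl)
  qed
  show ?thesis using le[of r r' s s'] le[of s s' r r'] assms by simp
qed

text \<open>The tableaux listed in \<open>pushes_hook\<close> are pairwise different: within a family the lower lines have
  different lengths, and the two families differ in the length of the first strip.\<close>
lemma sum_pushes_hook:
  assumes "ys \<noteq> []" "zs \<noteq> []"
  shows "sum F (pushes zs 0 (two_row ys [x] xs)) =
    (\<Sum>i\<le>min (length ys - 1) (length zs).
       F (two_row (hd ys # take i zs @ drop (Suc i) ys @ drop i zs) (x # take i (tl ys)) xs)) +
    (\<Sum>i\<le>min (length ys - 1) (length zs - 1).
       F (two_row (take (Suc i) zs @ drop (Suc i) ys @ drop (Suc i) zs) (take (Suc i) ys) (x # xs)))"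
proof -
  let ?a = "\<lambda>i. two_row (hd ys # take i zs @ drop (Suc i) ys @ drop i zs) (x # take i (tl ys)) xs"
  let ?b = "\<lambda>i. two_row (take (Suc i) zs @ drop (Suc i) ys @ drop (Suc i) zs) (take (Suc i) ys) (x # xs)"
  let ?A = "{..min (length ys - 1) (length zs)}" and ?B = "{..min (length ys - 1) (length zs - 1)}"
  have "inj_on ?a ?A"
  proof (rule inj_onI)
    fix i j assume "i \<in> ?A" "j \<in> ?A" "?a i = ?a j"
    then show "i = j" using two_row_length_cong[of _ _ xs, OF \<open>?a i = ?a j\<close>] by auto
  qed
  moreover have "inj_on ?b ?B"
  proof (rule inj_onI)
    fix i j assume *: "i \<in> ?B" "j \<in> ?B" "?b i = ?b j"
    then show "i = j" using two_row_length_cong[of _ _ "x # xs", OF *(3)] assms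
      by (auto simp: Suc_le_eq neq_Nil_conv)
  qed
  moreover have "?a ` ?A \<inter> ?b ` ?B = {}"
  proof -
    have "length (?a i 0) \<noteq> length (?b j 0)" for i j
      using assms by (auto simp: two_row_def)
    then show ?thesis by (metis (no_types, lifting) disjoint_iff imageE)
  qed
  ultimately show ?thesis
    using pushes_hook[OF refl refl, of ys zs x xs] assms
    by (simp add: sum.union_disjoint sum.reindex)
qed

section \<open>Exchanging the ends of two rows\<close>

context strip_order
begin

text \<open>The exchange at the first index where the lower line is related to the upper one: up to that index
  the two lines swap their letters, except that the upper letter at that index stays in the upper
  line, whose end thereby moves one place to the right.\<close>
fun switch :: "'a list \<Rightarrow> 'a list \<Rightarrow> 'a list \<times> 'a list" where
  "switch (u # r) (w # r') =
     (if R w u then (w # u # r, r') else (w # fst (switch r r'), u # snd (switch r r')))"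
| "switch r r' = (r, r')"

text \<open>The index of the exchange is the first one at which the upper letter is related to the lower one, or
  the end of the lower line if there is none.\<close>
fun unswitch :: "'a list \<Rightarrow> 'a list \<Rightarrow> 'a list \<times> 'a list" where
  "unswitch (w # r) [] = (r, [w])"
| "unswitch (w # r) (c # r') =
     (if R w c then (r, w # c # r') else (c # fst (unswitch r r'), w # snd (unswitch r r')))"
| "unswitch [] r' = ([], r')"

definition clash :: "'a list \<Rightarrow> 'a list \<Rightarrow> bool" where
  "clash r r' \<longleftrightarrow> (\<exists>i<length r'. R (r' ! i) (r ! i))"

lemma clash_simps [simp]:
  "\<not> clash r []"
  "clash (u # r) (w # r') \<longleftrightarrow> R w u \<or> clash r r'"
  by (auto simp: clash_def less_Suc_eq_0_disj)

abbreviation ascending :: "'a list \<Rightarrow> bool" where "ascending \<equiv> sorted_wrt R"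

text \<open>Before the exchange index \<open>R w u\<close> fails for the lower letter \<open>w\<close> and the upper letter \<open>u\<close>, so by \<open>cotrans\<close> every
  letter that may follow \<open>w\<close> may also follow \<open>u\<close>; this keeps the new lower line ascending.  The
  clause about \<open>drop\<close> says that everything beyond the reach of the lower line stays in place, up to the
  shift by one.\<close>
lemma switch_correct:
  assumes "ascending r" "ascending r'" "length r' \<le> length r" "clash r r'" "switch r r' = (s, s')"
  shows "ascending s \<and> ascending s' \<and> length s = Suc (length r) \<and> Suc (length s') = length r' \<and>
    hd s = hd r' \<and> mset s + mset s' = mset r + mset r' \<and>
    (\<forall>L. length r' \<le> Suc L \<longrightarrow> drop (Suc L) s = drop L r) \<and> unswitch s s' = (r, r')"
  using assms
proof (induction r r' arbitrary: s s' rule: switch.induct)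
  case (1 u r w r')
  show ?case
  proof (cases "R w u")
    case True
    then have "\<forall>v\<in>set r. R w v" using "1.prems" by (auto intro: trans[of w u])
    with True "1.prems" show ?thesis by (cases r') auto
  next
    case False
    obtain t t' where t: "switch r r' = (t, t')" by fastforce
    have s: "s = w # t" "s' = u # t'" using "1.prems" False t by auto
    have IH: "ascending t \<and> ascending t' \<and> length t = Suc (length r) \<and> Suc (length t') = length r' \<and>
      hd t = hd r' \<and> mset t + mset t' = mset r + mset r' \<and>
      (\<forall>L. length r' \<le> Suc L \<longrightarrow> drop (Suc L) t = drop L r) \<and> unswitch t t' = (r, r')"
      using "1.prems" False t by (intro "1.IH"(1)) auto
    have r': "r' \<noteq> []" using IH by auto
    have t_ne: "t \<noteq> []" using IH by auto
    have "R w (hd t)" using IH r' "1.prems" by (cases r') auto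
    moreover have tl: "R (hd t) v" if "v \<in> set (tl t)" for v
      using IH that t_ne by (cases t) auto
    ultimately have ht: "\<forall>v\<in>set t. R w v" using t_ne by (cases t) (auto intro: trans[of w "hd t"])
    have "\<forall>v\<in>set t'. R u v"
    proof
      fix v assume "v \<in> set t'"
      then have "v \<in># mset r + mset r'"
        using IH by (metis set_mset_mset union_iff)
      then show "R u v"
        using "1.prems" False cotrans[of w v u] by auto
    qed
    moreover have "drop L t = drop L (u # r)" if "Suc (length r') \<le> Suc L" for L
      using IH that r' by (cases L) auto
    ultimately show ?thesis using IH s ht False t_ne r' by auto
  qed
qed auto

lemma unswitch_correct:
  assumes "ascending s" "ascending s'" "Suc (length s') < length s" "unswitch s s' = (r, r')"
  shows "ascending r \<and> ascending r' \<and> length s = Suc (length r) \<and> Suc (length s') = length r' \<and>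
    clash r r' \<and> hd s = hd r' \<and> mset s + mset s' = mset r + mset r' \<and>
    (\<forall>L. length r' \<le> Suc L \<longrightarrow> drop (Suc L) s = drop L r) \<and> switch r r' = (s, s')"
  using assms
proof (induction s s' arbitrary: r r' rule: unswitch.induct)
  case (1 w s)
  then show ?case by (cases s) auto
next
  case (2 w s c s')
  show ?case
  proof (cases "R w c")
    case True
    then have "\<forall>v\<in>set s'. R w v" using "2.prems" by (auto intro: trans[of w c])
    with True "2.prems" show ?thesis by (cases s) auto
  next
    case False
    obtain t t' where t: "unswitch s s' = (t, t')" by fastforce
    have r: "r = c # t" "r' = w # t'" using "2.prems" False t by auto
    have IH: "ascending t \<and> ascending t' \<and> length s = Suc (length t) \<and> Suc (length s') = length t' \<and>
      clash t t' \<and> hd s = hd t' \<and> mset s + mset s' = mset t + mset t' \<and>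
      (\<forall>L. length t' \<le> Suc L \<longrightarrow> drop (Suc L) s = drop L t) \<and> switch t t' = (s, s')"
      using "2.prems" False t by (intro "2.IH"(1)) auto
    have ne: "t' \<noteq> []" "s \<noteq> []" using IH by auto
    have "R w (hd t')" using IH ne "2.prems" by (cases s) auto
    then have ht: "\<forall>v\<in>set t'. R w v" using IH ne by (cases t') (auto intro: trans[of w "hd t'"])
    have "\<forall>v\<in>set t. R c v"
    proof
      fix v assume "v \<in> set t"
      then have "v \<in># mset s + mset s'"
        using IH by (metis set_mset_mset union_iff)
      then show "R c v" using "2.prems" False cotrans[of w v c] by auto
    qed
    moreover have "drop L s = drop L (c # t)" if "Suc (length t') \<le> Suc L" for L
      using IH that ne by (cases L) auto
    ultimately show ?thesis using IH r ht False ne by auto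
  qed
qed auto

text \<open>Pairs of ascending lines with prescribed letters \<open>M\<close>, where the upper line ends with \<open>tau\<close>.  In the
  application \<open>tau\<close> consists of the inserted letters that the symmetrisation does not move.\<close>
definition rows :: "'a list \<Rightarrow> 'a multiset \<Rightarrow> nat \<Rightarrow> ('a list \<times> 'a list) set" where
  "rows tau M b = {(r, r'). (\<exists>r0. r = r0 @ tau) \<and> mset r + mset r' = M \<and> length r' = b \<and>
     ascending r \<and> ascending r'}"

lemma finite_rows: "finite (rows tau M b)"
proof (rule finite_subset)
  let ?L = "{r. set r \<subseteq> set_mset M \<and> length r \<le> size M}"
  show "rows tau M b \<subseteq> ?L \<times> ?L"
    by (auto simp: rows_def)
  show "finite (?L \<times> ?L)" by (simp add: finite_lists_length_le)
qed

lemma ascending_Cons_iff: "ascending (x # r) \<longleftrightarrow> ascending r \<and> (r = [] \<or> R x (hd r))"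
  by (cases r) (auto intro: trans)

text \<open>The first size bound says that the upper line is at least as long as the lower one, the second that
  \<open>tau\<close> lies beyond the reach of the exchange.  The first letter of the lower line becomes the first
  letter of the upper one, so that a condition \<open>A\<close> on it may be imposed.\<close>
lemma bij_switch:
  assumes "2 * p + 2 \<le> size M" "2 * p + 1 + length tau \<le> size M"
  shows "bij_betw (\<lambda>(r, r'). switch r r')
    {z \<in> rows tau M (Suc p). A (hd (snd z)) \<and> clash (fst z) (snd z)}
    {z \<in> rows tau M p. A (hd (fst z))}"
    (is "bij_betw ?f ?C ?B")
proof (rule bij_betw_byWitness[where f' = "\<lambda>(s, s'). unswitch s s'"])
  have fwd: "?f z \<in> ?B \<and> (case ?f z of (s, s') \<Rightarrow> unswitch s s') = z" if "z \<in> ?C" for z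
  proof -
    obtain r r' s s' where z: "z = (r, r')" and sw: "switch r r' = (s, s')" by fastforce
    from that z obtain r0 where r: "r = r0 @ tau" and M: "mset r + mset r' = M"
      and *: "length r' = Suc p" "ascending r" "ascending r'" "clash r r'" "A (hd r')"
      by (auto simp: rows_def)
    have n: "length r + Suc p = size M" using M * by (metis size_mset size_union)
    note sc = switch_correct[OF *(2,3) _ *(4) sw]
    have L: "length r' \<le> length r" "length r' \<le> Suc (length r0)"
      using n r * assms by auto
    have "drop (Suc (length r0)) s = tau" using sc L r by simp
    then have "\<exists>s0. s = s0 @ tau" by (metis append_take_drop_id)
    moreover have "mset s + mset s' = M" "ascending s" "ascending s'" "length s' = p" "A (hd s)"
      "unswitch s s' = (r, r')"
      using sc L(1) *(1,5) M by simp_all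
    ultimately show ?thesis using z sw by (simp add: rows_def)
  qed
  have bwd: "(case z of (s, s') \<Rightarrow> unswitch s s') \<in> ?C \<and> ?f (case z of (s, s') \<Rightarrow> unswitch s s') = z"
    if "z \<in> ?B" for z
  proof -
    obtain r r' s s' where z: "z = (s, s')" and sw: "unswitch s s' = (r, r')" by fastforce
    from that z obtain s0 where s: "s = s0 @ tau" and M: "mset s + mset s' = M"
      and *: "length s' = p" "ascending s" "ascending s'" "A (hd s)"
      by (auto simp: rows_def)
    have n: "length s + p = size M" using M * by (metis size_mset size_union)
    have "Suc (length s') < length s" using n * assms by auto
    note sc = unswitch_correct[OF *(2,3) this sw]
    obtain k where k: "length s0 = Suc k" "p \<le> k"
      using n s assms by (cases "length s0") auto
    have "drop (Suc k) s = tau" using s k by simp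
    then have "drop k r = tau" using sc k * by simp
    then have "\<exists>r0. r = r0 @ tau" by (metis append_take_drop_id)
    moreover have "mset r + mset r' = M" "ascending r" "ascending r'" "length r' = Suc p" "A (hd r')"
      "switch r r' = (s, s')" "clash r r'"
      using sc *(1,4) M by simp_all
    ultimately show ?thesis using z sw by (simp add: rows_def)
  qed
  show "\<forall>z\<in>?C. (case ?f z of (s, s') \<Rightarrow> unswitch s s') = z"
    by (intro ballI fwd[THEN conjunct2])
  show "\<forall>z\<in>?B. ?f (case z of (s, s') \<Rightarrow> unswitch s s') = z"
    by (intro ballI bwd[THEN conjunct2])
  show "?f ` ?C \<subseteq> ?B"
    by (intro image_subsetI fwd[THEN conjunct1])
  show "(\<lambda>(s, s'). unswitch s s') ` ?B \<subseteq> ?C"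
    by (intro image_subsetI bwd[THEN conjunct1])
qed

lemma card_rows_split:
  "card {z \<in> rows tau M b. B z} =
    card {z \<in> rows tau M b. B z \<and> A z} + card {z \<in> rows tau M b. B z \<and> \<not> A z}"
  by (subst card_Un_disjoint[symmetric])
    (auto intro: finite_subset[OF _ finite_rows] arg_cong[where f = card])

text \<open>The letter \<open>x\<close> is the second letter of the hook's first strip.  The four counts below are the numbers
  \<open>N\<close>, \<open>G\<close>, \<open>below\<close> and \<open>beside\<close> of the introduction: \<open>x\<close> may be put under the first letter of the upper line, under
  that of the lower line, under that of the lower line in a pair without violations, and in front of
  the lower line in a pair without violations.  The index \<open>b\<close> is the length of the lower line, not
  counting \<open>x\<close>.\<close>
definition count_top :: "'a \<Rightarrow> 'a list \<Rightarrow> 'a multiset \<Rightarrow> nat \<Rightarrow> nat" where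
  "count_top x tau M b = card {z \<in> rows tau M b. \<not> R x (hd (fst z))}"

definition count_bottom :: "'a \<Rightarrow> 'a list \<Rightarrow> 'a multiset \<Rightarrow> nat \<Rightarrow> nat" where
  "count_bottom x tau M b = card {z \<in> rows tau M b. snd z \<noteq> [] \<and> \<not> R x (hd (snd z))}"

definition count_below :: "'a \<Rightarrow> 'a list \<Rightarrow> 'a multiset \<Rightarrow> nat \<Rightarrow> nat" where
  "count_below x tau M b =
     card {z \<in> rows tau M b. \<not> clash (fst z) (snd z) \<and> \<not> R x (hd (snd z))}"

definition count_beside :: "'a \<Rightarrow> 'a list \<Rightarrow> 'a multiset \<Rightarrow> nat \<Rightarrow> nat" where
  "count_beside x tau M b =
     card {z \<in> rows tau M b. ascending (x # snd z) \<and> \<not> clash (fst z) (x # snd z)}"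

text \<open>Among the pairs counted on the left, the exchange maps the violating ones onto the pairs whose upper
  line may stand above \<open>x\<close>.\<close>
lemma count_bottom_Suc:
  assumes "2 * p + 2 \<le> size M" "2 * p + 1 + length tau \<le> size M"
  shows "count_bottom x tau M (Suc p) = count_below x tau M (Suc p) + count_top x tau M p"
proof -
  have "card {z \<in> rows tau M (Suc p). \<not> R x (hd (snd z)) \<and> clash (fst z) (snd z)} =
      card {z \<in> rows tau M p. \<not> R x (hd (fst z))}"
    using bij_betw_same_card[OF bij_switch[OF assms, of "\<lambda>u. \<not> R x u"]]
    by simp
  moreover have "{z \<in> rows tau M (Suc p). snd z \<noteq> [] \<and> \<not> R x (hd (snd z))} =
      {z \<in> rows tau M (Suc p). \<not> R x (hd (snd z))}"
    by (auto simp: rows_def)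
  ultimately show ?thesis
    using card_rows_split[of tau M "Suc p" "\<lambda>z. \<not> R x (hd (snd z))" "\<lambda>z. clash (fst z) (snd z)"]
    unfolding count_bottom_def count_below_def count_top_def by (simp add: conj_commute)
qed

text \<open>Among all pairs with lower line of length \<open>p\<close>, those not counted by \<open>count_top\<close> are the ones in which \<open>x\<close>
  can be prepended to the upper line, and those not counted by \<open>count_bottom\<close> are the ones in which \<open>x\<close>
  can be prepended to the lower line.  Of the latter, the pairs without violations are counted by
  \<open>count_beside\<close>, and the exchange maps the others onto the former, because it moves \<open>x\<close> from the front of the
  lower line to the front of the upper line.\<close>
lemma count_top_eq:
  assumes "2 * p < size M" "2 * p + length tau \<le> size M"
  shows "count_top x tau M p = count_beside x tau M p + count_bottom x tau M p"
proof -
  let ?T = "rows tau M p" and ?M = "add_mset x M"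
  have "card {z \<in> ?T. ascending (x # snd z) \<and> A (fst z) (x # snd z)} =
      card {z \<in> rows tau ?M (Suc p). hd (snd z) = x \<and> A (fst z) (snd z)}" for A
  proof (rule bij_betw_same_card, rule bij_betw_byWitness[where f' = "\<lambda>(r :: 'a list, r'). (r, tl r')"])
    let ?f = "\<lambda>(r, r'). (r, x # r')"
    have *: "(\<exists>r''. r' = x # r'' \<and> length r'' = p)" if "length r' = Suc p" "hd r' = x" for r'
      using that by (cases r') auto
    show "(\<lambda>(r, r'). (r, tl r')) ` {z \<in> rows tau ?M (Suc p). hd (snd z) = x \<and> A (fst z) (snd z)} \<subseteq>
        {z \<in> ?T. ascending (x # snd z) \<and> A (fst z) (x # snd z)}"
    proof (rule image_subsetI)
      fix z assume "z \<in> {z \<in> rows tau ?M (Suc p). hd (snd z) = x \<and> A (fst z) (snd z)}"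
      then obtain r r' where z: "z = (r, r')" "(r, r') \<in> rows tau ?M (Suc p)" "hd r' = x" "A r r'"
        by (cases z) auto
      then obtain r'' where r': "r' = x # r''" using *[of r'] by (auto simp: rows_def)
      show "(case z of (r, r') \<Rightarrow> (r, tl r')) \<in> {z \<in> ?T. ascending (x # snd z) \<and> A (fst z) (x # snd z)}"
        using z(2,4) unfolding r' z(1) by (auto simp: rows_def)
    qed
    show "\<forall>z\<in>{z \<in> rows tau ?M (Suc p). hd (snd z) = x \<and> A (fst z) (snd z)}.
        ?f ((\<lambda>(r, r'). (r, tl r')) z) = z"
    proof
      fix z assume "z \<in> {z \<in> rows tau ?M (Suc p). hd (snd z) = x \<and> A (fst z) (snd z)}"
      then obtain r r' where z: "z = (r, r')" "(r, r') \<in> rows tau ?M (Suc p)" "hd r' = x"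
        by (cases z) auto
      then obtain r'' where r': "r' = x # r''" using *[of r'] by (auto simp: rows_def)
      show "?f ((\<lambda>(r, r'). (r, tl r')) z) = z" unfolding z(1) r' by simp
    qed
  qed (auto simp: rows_def)
  note prepend_bottom = this
  have prepend_top: "card {z \<in> ?T. R x (hd (fst z))} = card {z \<in> rows tau ?M p. hd (fst z) = x}"
  proof (rule bij_betw_same_card, rule bij_betw_byWitness[where f' = "\<lambda>(r, r' :: 'a list). (tl r, r')"])
    let ?f = "\<lambda>(r, r'). (x # r, r')"
    have ne: "r \<noteq> []" if "(r, r') \<in> ?T" for r r'
      using that assms by (auto simp: rows_def)
    have *: "\<exists>r1. r = x # r1 @ tau \<and> r1 @ tau \<noteq> [] \<and> mset (r1 @ tau) + mset r' = M"
      if "(r, r') \<in> rows tau ?M p" and hd: "hd r = x" for r r'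
    proof -
      from that obtain r0 where r: "r = r0 @ tau" and M: "mset r + mset r' = ?M" and "length r' = p"
        by (auto simp: rows_def)
      then have n: "length r + p = Suc (size M)" by (metis size_mset size_union size_add_mset)
      then have "r0 \<noteq> []" using assms r by auto
      then obtain r1 where r1: "r0 = x # r1" using r hd by (cases r0) auto
      have "length (r1 @ tau) + p = size M" using n r r1 by simp
      then have "length (r1 @ tau) > 0" using assms by linarith
      then show ?thesis using r M r1 by simp
    qed
    show "?f ` {z \<in> ?T. R x (hd (fst z))} \<subseteq> {z \<in> rows tau ?M p. hd (fst z) = x}"
      by (auto simp: rows_def simp del: sorted_wrt.simps simp: ascending_Cons_iff)
    show "(\<lambda>(r, r'). (tl r, r')) ` {z \<in> rows tau ?M p. hd (fst z) = x} \<subseteq>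
        {z \<in> ?T. R x (hd (fst z))}"
    proof (rule image_subsetI)
      fix z assume "z \<in> {z \<in> rows tau ?M p. hd (fst z) = x}"
      then obtain r r' where z: "z = (r, r')" "(r, r') \<in> rows tau ?M p" "hd r = x"
        by (cases z) auto
      then obtain r1 where r: "r = x # r1 @ tau" "r1 @ tau \<noteq> []" "mset (r1 @ tau) + mset r' = M"
        using * by metis
      have "ascending (x # r1 @ tau)" using z(2) unfolding r(1) by (simp add: rows_def)
      then have "R x (hd (r1 @ tau))" using r(2) by (subst (asm) ascending_Cons_iff) auto
      then show "(case z of (r, r') \<Rightarrow> (tl r, r')) \<in> {z \<in> ?T. R x (hd (fst z))}"
        using z(2) r(3) unfolding z(1) r(1) by (auto simp: rows_def)
    qed
    show "\<forall>z\<in>{z \<in> rows tau ?M p. hd (fst z) = x}. ?f ((\<lambda>(r, r'). (tl r, r')) z) = z"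
      using * by auto (metis list.sel(1) list.sel(3))
  qed auto
  have "card {z \<in> rows tau ?M (Suc p). hd (snd z) = x \<and> clash (fst z) (snd z)} = card {z \<in> rows tau ?M p. hd (fst z) = x}"
    using bij_betw_same_card[OF bij_switch[of p ?M tau "\<lambda>u. u = x"]] assms
    by simp
  moreover have "count_beside x tau M p =
      card {z \<in> rows tau ?M (Suc p). hd (snd z) = x \<and> \<not> clash (fst z) (snd z)}"
    using prepend_bottom[of "\<lambda>r r'. \<not> clash r r'"] by (simp only: count_beside_def)
  ultimately have "card {z \<in> ?T. ascending (x # snd z)} =
      count_beside x tau M p + card {z \<in> ?T. R x (hd (fst z))}"
    using card_rows_split[of tau ?M "Suc p" "\<lambda>z. hd (snd z) = x" "\<lambda>z. clash (fst z) (snd z)"]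
      prepend_bottom[of "\<lambda>_ _. True"] prepend_top
    by (simp del: sorted_wrt.simps)
  moreover have "card ?T = card {z \<in> ?T. R x (hd (fst z))} + count_top x tau M p"
    using card_rows_split[of tau M p "\<lambda>_. True" "\<lambda>z. R x (hd (fst z))"]
    by (simp add: count_top_def)
  moreover have "card ?T = card {z \<in> ?T. ascending (x # snd z)} + count_bottom x tau M p"
  proof -
    have "{z \<in> ?T. \<not> ascending (x # snd z)} = {z \<in> ?T. snd z \<noteq> [] \<and> \<not> R x (hd (snd z))}"
      by (auto simp: rows_def ascending_Cons_iff simp del: sorted_wrt.simps)
    then show ?thesis
      using card_rows_split[of tau M p "\<lambda>_. True" "\<lambda>z. ascending (x # snd z)"]
      by (simp add: count_bottom_def del: sorted_wrt.simps)
  qed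
  ultimately show ?thesis by simp
qed

lemma count_top_sum:
  assumes "2 * p < size M" "2 * p + length tau \<le> size M"
  shows "count_top x tau M p = (\<Sum>i\<le>p. count_beside x tau M i) + (\<Sum>i<p. count_below x tau M (Suc i))"
  using assms
proof (induction p)
  case 0
  have "count_bottom x tau M 0 = 0"
    by (auto simp: count_bottom_def rows_def card_eq_0_iff)
  then show ?case using count_top_eq[of 0 M tau x] 0 by simp
next
  case (Suc p)
  then show ?case
    using count_top_eq[of "Suc p" M tau x] count_bottom_Suc[of p M tau x] by simp
qed

end

section \<open>Counting the permutations that make a tableau semistandard\<close>

text \<open>The letter on top of the first strip is covered by its comparison with \<open>hd r'\<close>, as the relation down
  a strip is transitive.\<close>
lemma (in strip_order) semistandard_two_row:
  assumes "length r' \<le> length r" "r' = [] \<Longrightarrow> xi = []"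
  shows "semistandard R (two_row r r' xi) \<longleftrightarrow> ascending r \<and> ascending r' \<and> \<not> clash r r' \<and>
    (r' \<noteq> [] \<longrightarrow> sorted_wrt (\<lambda>u v. \<not> R v u) (hd r' # xi))"
proof
  let ?C = "two_row r r' xi"
  assume semistandard: "semistandard R ?C"
  have C0: "?C j ! 0 = r ! j" "0 < length (?C j)" if "j < length r" for j
    using that by (auto simp: two_row_def)
  have C1: "?C j ! 1 = r' ! j" "1 < length (?C j)" if "j < length r'" for j
    using that assms by (auto simp: two_row_def)
  have across: "R (?C j ! i) (?C j' ! i)" if "j < j'" "i < length (?C j)" "i < length (?C j')" for i j j'
    using semistandard that by (simp add: semistandard_def)
  have "R (r ! j) (r ! j')" if "j < j'" "j' < length r" for j j'
    using across[of j j' 0] C0[of j] C0[of j'] that by simp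
  then have "ascending r" by (simp add: sorted_wrt_iff_nth_less)
  moreover have "R (r' ! j) (r' ! j')" if "j < j'" "j' < length r'" for j j'
    using across[of j j' 1] C1[of j] C1[of j'] that by simp
  then have "ascending r'" by (simp add: sorted_wrt_iff_nth_less)
  moreover have "\<not> R (r' ! j) (r ! j)" if "j < length r'" for j
  proof -
    have "sorted_wrt (\<lambda>u v. \<not> R v u) (?C j)" using semistandard by (simp add: semistandard_def)
    then show ?thesis using that assms by (auto simp: two_row_def split: if_splits)
  qed
  moreover have "sorted_wrt (\<lambda>u v. \<not> R v u) (hd r' # xi)" if "r' \<noteq> []"
  proof -
    have "sorted_wrt (\<lambda>u v. \<not> R v u) (?C 0)" using semistandard by (simp add: semistandard_def)
    then show ?thesis using that assms by (auto simp: two_row_def hd_conv_nth split: if_splits)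
  qed
  ultimately show "ascending r \<and> ascending r' \<and> \<not> clash r r' \<and>
      (r' \<noteq> [] \<longrightarrow> sorted_wrt (\<lambda>u v. \<not> R v u) (hd r' # xi))"
    by (auto simp: clash_def)
next
  let ?C = "two_row r r' xi"
  assume *: "ascending r \<and> ascending r' \<and> \<not> clash r r' \<and>
      (r' \<noteq> [] \<longrightarrow> sorted_wrt (\<lambda>u v. \<not> R v u) (hd r' # xi))"
  have "sorted_wrt (\<lambda>u v. \<not> R v u) (?C j)" for j
  proof (cases "r' = []")
    case True
    then show ?thesis using assms by (auto simp: two_row_def)
  next
    case False
    then have r: "r \<noteq> []" "r' ! 0 = hd r'" using assms by (auto simp: hd_conv_nth)
    have Q: "\<not> R (r' ! j) (r ! j)" if "j < length r'" for j
      using * that by (simp add: clash_def)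
    moreover have "\<not> R (hd r') (r ! 0)" using Q[of 0] False r by simp
    moreover have "\<not> R v (r ! 0)" if "v \<in> set xi" for v
      using * that False Q[of 0] r cotrans[of v "r ! 0" "hd r'"] by auto
    ultimately show ?thesis
      using * False assms r by (auto simp: two_row_def)
  qed
  moreover have "R (?C j ! i) (?C j' ! i)"
    if "j < j'" "i < length (?C j)" "i < length (?C j')" for i j j'
  proof -
    have "i = 0 \<and> j' < length r \<or> i = 1 \<and> j' < length r'"
      using that assms by (auto simp: two_row_def split: if_splits)
    then show ?thesis
      using that assms * by (auto simp: two_row_def sorted_wrt_iff_nth_less)
  qed
  ultimately show "semistandard R ?C" unfolding semistandard_def by blast
qed

text \<open>A permutation of \<open>S\<close> is the same as a rearrangement of the letters of \<open>S\<close>, read along the two lines.\<close>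
lemma (in strip_order) card_perm_rows:
  assumes "distinct (al @ be)" "S = set (al @ be)"
  shows "card {p. p permutes S \<and> ascending (map p al @ tau) \<and> ascending (map p be) \<and> A (map p al @ tau) (map p be)} =
    card {z \<in> rows tau (mset_set S + mset tau) (length be). A (fst z) (snd z)}"
proof (rule bij_betw_same_card[of "\<lambda>p. (map p al @ tau, map p be)"], rule bij_betw_imageI)
  show "inj_on (\<lambda>p. (map p al @ tau, map p be))
      {p. p permutes S \<and> ascending (map p al @ tau) \<and> ascending (map p be) \<and> A (map p al @ tau) (map p be)}"
  proof (rule inj_onI, clarsimp)
    fix p q assume pq: "p permutes S" "q permutes S"
      and "\<forall>x\<in>set al. p x = q x" "\<forall>x\<in>set be. p x = q x"
    then have "p x = q x" if "x \<in> S" for x using that assms(2) by auto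
    then show "p = q" using pq by (metis permutes_not_in ext)
  qed
  have S: "mset (al @ be) = mset_set S" using assms by (metis mset_set_set)
  show "(\<lambda>p. (map p al @ tau, map p be)) ` {p. p permutes S \<and> ascending (map p al @ tau) \<and>
      ascending (map p be) \<and> A (map p al @ tau) (map p be)} =
    {z \<in> rows tau (mset_set S + mset tau) (length be). A (fst z) (snd z)}" (is "?l = ?r")
  proof (intro equalityI subsetI)
    fix z assume "z \<in> ?l"
    then obtain p where p: "p permutes S" and z: "z = (map p al @ tau, map p be)"
      "ascending (map p al @ tau)" "ascending (map p be)" "A (map p al @ tau) (map p be)" by auto
    have "mset (map p al @ map p be) = image_mset p (mset_set S)" by (metis S map_append mset_map)
    also have "\<dots> = mset_set S"
      using permutes_image[OF p] by (simp add: image_mset_mset_set permutes_inj_on[OF p])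
    finally show "z \<in> ?r" using z by (auto simp: rows_def)
  next
    fix z assume "z \<in> ?r"
    then obtain r r' where z: "z = (r @ tau, r')" and len: "length r' = length be"
      and m: "mset (r @ r') = mset_set S" and "ascending (r @ tau)" "ascending r'" "A (r @ tau) r'"
      by (auto simp: rows_def)
    have "set (r @ r') = S" using m S assms(2) by (metis mset_eq_setD)
    have len': "length r = length al"
      using m S len by (metis add_right_cancel length_append size_mset)
    define p where "p x = (if x \<in> S then the (map_of (zip (al @ be) (r @ r')) x) else x)" for x
    have map: "map p (al @ be) = r @ r'"
    proof (rule nth_equalityI)
      fix i assume "i < length (map p (al @ be))"
      then have i: "i < length (al @ be)" "i < length (r @ r')" using len len' by simp_all
      have "map_of (zip (al @ be) (r @ r')) ((al @ be) ! i) = Some ((r @ r') ! i)"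
        using i assms(1) len len' by (intro map_of_zip_nth) simp_all
      moreover have "(al @ be) ! i \<in> S" using i(1) assms(2) nth_mem by blast
      ultimately have "p ((al @ be) ! i) = (r @ r') ! i" by (simp only: p_def if_True option.sel)
      then show "map p (al @ be) ! i = (r @ r') ! i" using i(1) by (simp only: nth_map)
    qed (simp add: len len')
    have "p permutes S"
    proof (rule bij_imp_permutes)
      have "p ` S = S" using map \<open>set (r @ r') = S\<close> assms(2) by (metis set_map)
      moreover have "finite S" using assms(2) by simp
      ultimately show "bij_betw p S S" by (simp add: bij_betw_def eq_card_imp_inj_on)
    qed (simp add: p_def)
    moreover have "map p al = r" "map p be = r'" using map len' by auto
    ultimately show "z \<in> ?l" using z \<open>ascending (r @ tau)\<close> \<open>ascending r'\<close> \<open>A (r @ tau) r'\<close> by force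
  qed
qed

text \<open>For the four kinds of configurations the permutations that make them semistandard are the pairs of
  lines counted above, provided that the strip \<open>x # xs\<close>, whose letters the permutations fix, ascends; if
  it does not, no permutation qualifies.\<close>
lemma (in strip_order) permuted_conditions:
  assumes "distinct (al @ be)" "S = set (al @ be)" "set (tau @ x # xs) \<inter> S = {}" "length be \<le> length al + length tau"
  defines "M \<equiv> mset_set S + mset tau"
    and "col \<equiv> sorted_wrt (\<lambda>u v. \<not> R v u) (x # xs)"
  shows "length be < length al + length tau \<Longrightarrow>
      card {p. p permutes S \<and> semistandard (\<lambda>u v. R (p u) (p v)) (two_row (al @ tau) (x # be) xs)} =
        (if col then count_beside x tau M (length be) else 0)"
    and "be \<noteq> [] \<Longrightarrow>
      card {p. p permutes S \<and> semistandard (\<lambda>u v. R (p u) (p v)) (two_row (al @ tau) be (x # xs))} =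
        (if col then count_below x tau M (length be) else 0)"
    and "al @ tau \<noteq> [] \<Longrightarrow>
      card {p. p permutes S \<and> semistandard (\<lambda>u v. R (p u) (p v)) (two_row (al @ tau) [x] xs) \<and>
          semistandard (\<lambda>u v. R (p u) (p v)) (two_row be [] [])} =
        (if col then count_top x tau M (length be) else 0)"
    and "be \<noteq> [] \<Longrightarrow>
      card {p. p permutes S \<and> semistandard (\<lambda>u v. R (p u) (p v)) (two_row be [x] xs) \<and>
          semistandard (\<lambda>u v. R (p u) (p v)) (two_row (al @ tau) [] [])} =
        (if col then count_bottom x tau M (length be) else 0)"
proof -
  have fix_letter: "p u = u" if "p permutes S" "u \<in> set (tau @ x # xs)" for p u
    using that assms(3) by (auto simp: permutes_def)
  have fixed: "map p tau = tau" "p x = x" "map p xs = xs" if "p permutes S" for p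
    using fix_letter[OF that] by (auto intro: map_idI)
  have card_if: "card {p. p permutes S \<and> B p} = (if col then n else 0)"
    if "\<And>p. p permutes S \<Longrightarrow> B p \<longleftrightarrow>
        col \<and> ascending (map p al @ tau) \<and> ascending (map p be) \<and> A (map p al @ tau) (map p be)"
      and "n = card {z \<in> rows tau M (length be). A (fst z) (snd z)}" for B A n
  proof -
    have "{p. p permutes S \<and> B p} = (if col then {p. p permutes S \<and> ascending (map p al @ tau) \<and>
        ascending (map p be) \<and> A (map p al @ tau) (map p be)} else {})"
      using that(1) by auto
    then show ?thesis
      using card_perm_rows[OF assms(1,2), of tau A] that(2) by (simp add: M_def)
  qed
  show "card {p. p permutes S \<and> semistandard (\<lambda>u v. R (p u) (p v)) (two_row (al @ tau) (x # be) xs)} =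
        (if col then count_beside x tau M (length be) else 0)"
    if "length be < length al + length tau"
    unfolding semistandard_map map_two_row
  proof (rule card_if[where A = "\<lambda>r r'. ascending (x # r') \<and> \<not> clash r (x # r')"])
    show "semistandard R (two_row (map p (al @ tau)) (map p (x # be)) (map p xs)) \<longleftrightarrow>
      col \<and> ascending (map p al @ tau) \<and> ascending (map p be) \<and>
        (ascending (x # map p be) \<and> \<not> clash (map p al @ tau) (x # map p be))" if p: "p permutes S" for p
      using semistandard_two_row[of "x # map p be" "map p al @ tau" xs] that
        \<open>length be < length al + length tau\<close>
      by (auto simp: fixed[OF p] col_def)
  qed (simp add: count_beside_def)
  show "card {p. p permutes S \<and> semistandard (\<lambda>u v. R (p u) (p v)) (two_row (al @ tau) be (x # xs))} =
        (if col then count_below x tau M (length be) else 0)" if "be \<noteq> []"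
  proof (unfold semistandard_map map_two_row, rule card_if[where A = "\<lambda>r r'. \<not> clash r r' \<and> \<not> R x (hd r')"])
    have "sorted_wrt (\<lambda>u v. \<not> R v u) (u # x # xs) \<longleftrightarrow> col \<and> \<not> R x u" for u
      using transp_not_converse by (auto simp: col_def sorted_wrt2 simp del: sorted_wrt.simps(2))
    then show "semistandard R (two_row (map p (al @ tau)) (map p be) (map p (x # xs))) \<longleftrightarrow>
      col \<and> ascending (map p al @ tau) \<and> ascending (map p be) \<and>
        (\<not> clash (map p al @ tau) (map p be) \<and> \<not> R x (hd (map p be)))" if "p permutes S" for p
      using semistandard_two_row[of "map p be" "map p al @ tau" "x # xs"] assms(4) \<open>be \<noteq> []\<close>
      by (auto simp: fixed[OF that] simp del: sorted_wrt.simps)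
  qed (simp add: count_below_def)
  show "card {p. p permutes S \<and> semistandard (\<lambda>u v. R (p u) (p v)) (two_row (al @ tau) [x] xs) \<and>
          semistandard (\<lambda>u v. R (p u) (p v)) (two_row be [] [])} =
        (if col then count_top x tau M (length be) else 0)" if "al @ tau \<noteq> []"
    unfolding semistandard_map map_two_row
  proof (rule card_if[where A = "\<lambda>r r'. \<not> R x (hd r)"])
    have "clash r [x] \<longleftrightarrow> R x (hd r)" if "r \<noteq> []" for r
      using that by (cases r) auto
    then show "semistandard R (two_row (map p (al @ tau)) (map p [x]) (map p xs)) \<and>
        semistandard R (two_row (map p be) (map p []) (map p [])) \<longleftrightarrow>
      col \<and> ascending (map p al @ tau) \<and> ascending (map p be) \<and> \<not> R x (hd (map p al @ tau))"
      if "p permutes S" for p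
      using semistandard_two_row[of "[x]" "map p al @ tau" xs] semistandard_two_row[of "[]" "map p be" "[]"]
        \<open>al @ tau \<noteq> []\<close>
      by (auto simp: fixed[OF that] col_def Suc_le_eq)
  qed (simp add: count_top_def)
  show "card {p. p permutes S \<and> semistandard (\<lambda>u v. R (p u) (p v)) (two_row be [x] xs) \<and>
          semistandard (\<lambda>u v. R (p u) (p v)) (two_row (al @ tau) [] [])} =
        (if col then count_bottom x tau M (length be) else 0)" if "be \<noteq> []"
    unfolding semistandard_map map_two_row
  proof (rule card_if[where A = "\<lambda>r r'. r' \<noteq> [] \<and> \<not> R x (hd r')"])
    have "clash r [x] \<longleftrightarrow> R x (hd r)" if "r \<noteq> []" for r
      using that by (cases r) auto
    then show "semistandard R (two_row (map p be) (map p [x]) (map p xs)) \<and>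
        semistandard R (two_row (map p (al @ tau)) (map p []) (map p [])) \<longleftrightarrow>
      col \<and> ascending (map p al @ tau) \<and> ascending (map p be) \<and> map p be \<noteq> [] \<and> \<not> R x (hd (map p be))"
      if "p permutes S" for p
      using semistandard_two_row[of "[x]" "map p be" xs] semistandard_two_row[of "[]" "map p al @ tau" "[]"]
        \<open>be \<noteq> []\<close>
      by (auto simp: fixed[OF that] col_def Suc_le_eq)
  qed (simp add: count_bottom_def)
qed

text \<open>The case distinction comes from the order of the two lines in the product.  If there are fewer
  letters \<open>zs\<close> than \<open>ys\<close>, then \<open>zs\<close> is taken as the lower line, all letters are moved by the permutations,
  and \<open>x\<close> stands under the upper line.  Otherwise \<open>ys\<close> is the lower line, and \<open>x\<close> stands under it.\<close>
lemma (in strip_order) count_identity: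
  assumes dist: "distinct (ys @ zs @ x # xs)" and ne: "ys \<noteq> []" "zs \<noteq> []"
    and q: "q = min (length ys - 1) (length zs)" and S: "S = set ys \<union> set (take q zs)"
  shows "card {p. p permutes S \<and> semistandard (\<lambda>u v. R (p u) (p v)) (two_row ys [x] xs) \<and>
      semistandard (\<lambda>u v. R (p u) (p v)) (two_row zs [] [])} =
    (\<Sum>C\<in>pushes zs 0 (two_row ys [x] xs). card {p. p permutes S \<and> semistandard (\<lambda>u v. R (p u) (p v)) C})"
proof -
  \<comment> \<open>The inserted letters outside \<open>S\<close>.\<close>
  define tau where "tau = drop q zs"
  define M where "M = mset_set S + mset tau"
  define col where "col \<longleftrightarrow> sorted_wrt (\<lambda>u v. \<not> R v u) (x # xs)"
  obtain y ys' where ys: "ys = y # ys'" using ne by (cases ys) auto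
  have pos: "0 < length ys" "0 < length zs" using ne by simp_all
  have zs: "zs = take q zs @ tau" by (simp add: tau_def)
  have dist_S: "distinct (ys @ take q zs)" using dist by (auto dest: in_set_takeD)
  then have mset_S: "mset_set S = mset ys + mset (take q zs)"
    using mset_set_set[of "ys @ take q zs"] by (simp add: S)
  have disj: "set (tau @ x # xs) \<inter> S = {}"
    using dist set_take_disj_set_drop_if_distinct[of zs q q]
    by (auto simp: S tau_def dest: in_set_takeD in_set_dropD)
  have len: "length tau = length zs - q" "size M = length ys + length zs"
    using q by (auto simp: tau_def M_def mset_S)
  have cover: "distinct (al @ be) \<and> S = set (al @ be)"
    if "mset (al @ be) = mset_set S" for al be
  proof -
    have "mset (al @ be) = mset (ys @ take q zs)" using that mset_S by simp
    then show ?thesis using dist_S S by (metis mset_eq_imp_distinct_iff mset_eq_setD set_append)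
  qed
  have beside: "card {p. p permutes S \<and> semistandard (\<lambda>u v. R (p u) (p v))
      (two_row (hd ys # take i zs @ drop (Suc i) ys @ drop i zs) (x # take i (tl ys)) xs)} =
      (if col then count_beside x tau M i else 0)" if "i \<le> q" for i
  proof -
    let ?al = "y # take i (take q zs) @ drop i ys' @ drop i (take q zs)" and ?be = "take i ys'"
    have m: "mset (?al @ ?be) = mset_set S"
    proof -
      have "mset ys' = mset (take i ys') + mset (drop i ys')"
        "mset (take q zs) = mset (take i (take q zs)) + mset (drop i (take q zs))"
        by (metis append_take_drop_id mset_append)+
      then show ?thesis unfolding mset_S ys by simp
    qed
    have eq: "hd ys # take i zs @ drop (Suc i) ys @ drop i zs = ?al @ tau" "take i (tl ys) = ?be"
    proof -
      have "drop i (take q zs @ tau) = drop i (take q zs) @ tau"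
        using that q by (simp only: drop_append) simp
      moreover have "take i zs = take i (take q zs)" using that by (simp add: min_def)
      ultimately show "hd ys # take i zs @ drop (Suc i) ys @ drop i zs = ?al @ tau"
        using zs by (simp add: ys)
    qed (simp add: ys)
    have "length ?be = i" and l: "length ?be < length ?al + length tau"
      using that q len ys by auto
    then show ?thesis
      using permuted_conditions(1)[OF cover[OF m, THEN conjunct1] cover[OF m, THEN conjunct2] disj less_imp_le[OF l] l,
        folded M_def col_def]
      unfolding eq by (simp only:)
  qed
  have below: "card {p. p permutes S \<and> semistandard (\<lambda>u v. R (p u) (p v))
      (two_row (take (Suc i) zs @ drop (Suc i) ys @ drop (Suc i) zs) (take (Suc i) ys) (x # xs))} =
      (if col then count_below x tau M (Suc i) else 0)" if "i \<le> min (length ys - 1) (length zs - 1)" for i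
  proof -
    let ?be = "take (Suc i) ys"
    have len_be: "length ?be = Suc i" using that ne by (cases ys) auto
    have "\<exists>al. take (Suc i) zs @ drop (Suc i) ys @ drop (Suc i) zs = al @ tau"
    \<comment> \<open>If \<open>Suc i\<close> exceeds \<open>q\<close>, all strips are pushed; the letter at index \<open>q\<close> of \<open>zs\<close>, which is not in \<open>S\<close>, then
      follows \<open>take q zs\<close> directly and again belongs to the end of the upper line.\<close>
    proof (cases "Suc i \<le> q")
      case True
      then have "drop (Suc i) zs = drop (Suc i) (take q zs) @ tau"
        using q by (subst zs) simp
      then show ?thesis by (metis append_assoc)
    next
      case False
      then have "drop (Suc i) ys = []" using that q ne by (cases zs) auto
      then show ?thesis using zs by (metis append_Nil append_take_drop_id)
    qed
    then obtain al where al: "take (Suc i) zs @ drop (Suc i) ys @ drop (Suc i) zs = al @ tau" by blast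
    have "mset (al @ ?be) + mset tau = mset ys + mset zs"
    proof -
      have split: "mset r = mset (take (Suc i) r) + mset (drop (Suc i) r)" for r :: "'a list"
        by (metis append_take_drop_id mset_append)
      have "mset (al @ ?be) + mset tau = mset (al @ tau) + mset ?be" by simp
      also have "\<dots> = mset ys + mset zs"
        unfolding al[symmetric] split[of ys] split[of zs] by simp
      finally show ?thesis .
    qed
    also have "mset zs = mset (take q zs) + mset tau" by (metis mset_append zs)
    finally have m: "mset (al @ ?be) = mset_set S" by (simp add: mset_S)
    have "length al + length tau + Suc i = length ys + length zs"
      using arg_cong[OF al, of length, simplified] that pos by arith
    then have "Suc i \<le> length al + length tau" using that pos by arith
    then have l: "length ?be \<le> length al + length tau" and "?be \<noteq> []"
      using len_be ne by auto
    then show ?thesis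
      using permuted_conditions(2)[OF cover[OF m, THEN conjunct1] cover[OF m, THEN conjunct2] disj l,
        folded M_def col_def]
      unfolding al len_be by (simp only: simp_thms)
  qed
  have total: "(\<Sum>C\<in>pushes zs 0 (two_row ys [x] xs). card {p. p permutes S \<and> semistandard (\<lambda>u v. R (p u) (p v)) C}) =
    (if col then (\<Sum>i\<le>q. count_beside x tau M i) +
      (\<Sum>i\<le>min (length ys - 1) (length zs - 1). count_below x tau M (Suc i)) else 0)"
    unfolding sum_pushes_hook[OF ne] q[symmetric]
    by (cases col) (auto simp: beside below intro!: arg_cong2[where f = "(+)"] sum.cong simp del: take_Suc drop_Suc One_nat_def)
  show ?thesis
  proof (cases "length zs < length ys")
    case True
    then have tau: "tau = []" "q = length zs" "take q zs = zs" using q by (auto simp: tau_def)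
    have "card {p. p permutes S \<and> semistandard (\<lambda>u v. R (p u) (p v)) (two_row ys [x] xs) \<and>
        semistandard (\<lambda>u v. R (p u) (p v)) (two_row zs [] [])} = (if col then count_top x tau M (length zs) else 0)"
    proof -
      have m: "mset (ys @ zs) = mset_set S" using tau by (simp add: mset_S)
      have "length zs \<le> length ys + length tau" "ys @ tau \<noteq> []" using True ne by simp_all
      from permuted_conditions(3)[OF cover[OF m, THEN conjunct1] cover[OF m, THEN conjunct2] disj this,
        folded M_def col_def]
      show ?thesis unfolding tau(1) append_Nil2 .
    qed
    also have "count_top x tau M (length zs) =
        (\<Sum>i\<le>length zs. count_beside x tau M i) + (\<Sum>i<length zs. count_below x tau M (Suc i))"
      using len True tau by (intro count_top_sum) auto
    also have "{..<length zs} = {..min (length ys - 1) (length zs - 1)}"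
      using True ne by (cases zs) auto
    finally show ?thesis unfolding total tau(2) by simp
  next
    case False
    then have q': "q = length ys - 1" "Suc q = length ys" using q ne by (auto simp: Suc_leI)
    have "card {p. p permutes S \<and> semistandard (\<lambda>u v. R (p u) (p v)) (two_row ys [x] xs) \<and>
        semistandard (\<lambda>u v. R (p u) (p v)) (two_row zs [] [])} = (if col then count_bottom x tau M (Suc q) else 0)"
    proof -
      have m: "mset (take q zs @ ys) = mset_set S" by (simp add: mset_S)
      have "length ys \<le> length (take q zs) + length tau"
        unfolding length_append[symmetric] zs[symmetric] using False by simp
      from permuted_conditions(4)[OF cover[OF m, THEN conjunct1] cover[OF m, THEN conjunct2] disj this ne(1),
        folded M_def col_def]
      show ?thesis unfolding zs[symmetric] q'(2) .
    qed
    also have "count_bottom x tau M (Suc q) = count_below x tau M (Suc q) + count_top x tau M q"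
      using len q' False by (intro count_bottom_Suc) auto
    also have "count_top x tau M q = (\<Sum>i\<le>q. count_beside x tau M i) + (\<Sum>i<q. count_below x tau M (Suc i))"
      using len q' False by (intro count_top_sum) auto
    also have "count_below x tau M (Suc q) + (\<dots>) =
        (\<Sum>i\<le>q. count_beside x tau M i) + (\<Sum>i\<le>q. count_below x tau M (Suc i))"
      by (simp add: lessThan_Suc_atMost[symmetric])
    finally have "card {p. p permutes S \<and> semistandard (\<lambda>u v. R (p u) (p v)) (two_row ys [x] xs) \<and>
        semistandard (\<lambda>u v. R (p u) (p v)) (two_row zs [] [])} =
      (if col then (\<Sum>i\<le>q. count_beside x tau M i) + (\<Sum>i\<le>q. count_below x tau M (Suc i)) else 0)" .
    moreover have "min (length ys - 1) (length zs - 1) = q" using q' False by auto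
    ultimately show ?thesis unfolding total by (simp only:)
  qed
qed

section \<open>The symmetrised product identity\<close>

text \<open>A letter either keeps its variable or receives one with real part greater than one.\<close>
lemma W_permute:
  assumes "p permutes S" "\<forall>a\<in>S. 1 < Re (v a)" "subst_tab mu v s \<in> W mu"
  shows "subst_tab mu (v \<circ> p) s \<in> W mu"
proof -
  have "1 < Re (v (p a)) \<or> p a = a" for a
    using assms(1,2) by (metis permutes_in_image permutes_not_in)
  then have "1 \<le> Re (v (p a))" if "1 \<le> Re (v a)" for a using that by (metis less_imp_le)
  moreover have "1 < Re (v (p a))" if "1 < Re (v a)" for a
    using that \<open>\<And>a. 1 < Re (v (p a)) \<or> p a = a\<close> by metis
  ultimately show ?thesis
    using assms(3) unfolding W_def by (auto simp: subst_tab_def tableaux_def corners_def)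
qed

text \<open>Both parts of the theorem in the language of strips.\<close>
lemma pushing_identity:
  fixes ys zs xs :: "indet list" and v :: "indet \<Rightarrow> complex"
  assumes dist: "distinct (ys @ zs @ x # xs)" and ne: "ys \<noteq> []" "zs \<noteq> []"
    and q: "q = min (length ys - 1) (length zs)" and S: "S = set ys \<union> set (take q zs)"
    and lam: "diagram lam = cells T (two_row ys [x] xs)" and kap: "diagram kap = cells T (two_row zs [] [])"
    and W: "subst_tab lam v (tab T (two_row ys [x] xs)) \<in> W lam"
      "subst_tab kap v (tab T (two_row zs [] [])) \<in> W kap"
    and Re: "\<forall>a\<in>S. 1 < Re (v a)"
  shows "sum_sym S v (\<lambda>w. schur_mzv lam (subst_tab lam w (tab T (two_row ys [x] xs))) *
      schur_mzv kap (subst_tab kap w (tab T (two_row zs [] [])))) =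
    sum_sym S v (\<lambda>w. \<Sum>C\<in>pushes zs 0 (two_row ys [x] xs).
      schur_mzv (shape (cells T C)) (subst_tab (shape (cells T C)) w (tab T C)))"
proof -
  let ?C = "two_row ys [x] xs" and ?B = "two_row zs [] []"
  define V1 where "V1 = set (ys @ x # xs)"
  define V where "V = V1 \<union> set zs"
  define R where "R f = (\<lambda>u v. along T (f u) (f v))" for f :: "indet \<Rightarrow> nat"
  have fin: "finite V1" "finite (set zs)" "V1 \<inter> set zs = {}" using dist by (auto simp: V1_def)
  have fills: "fills V1 ?C" "fills (set zs) ?B"
    using fills_two_row_hook[of ys x xs] fills_two_row_single[of zs] dist ne by (auto simp: V1_def)
  have stacked: "stacked ?C" using stacked_hook ne(1) .
  have "S \<subseteq> V" by (auto simp: S V_def V1_def dest: in_set_takeD)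
  then have SV: "p permutes V" if "p permutes S" for p
    using permutes_subset[OF that] by blast
  have "finite S" by (simp add: S)
  then have fin_perms: "finite {p. p permutes S}" by (rule finite_permutations)
  have fin_pushes: "finite (pushes zs 0 ?C)" using pushes_hook[OF refl refl, of ys zs x xs] ne by simp
  define A where "A p = {f \<in> V \<rightarrow>\<^sub>E {1..}. semistandard (R (f \<circ> p)) ?C \<and> semistandard (R (f \<circ> p)) ?B}" for p
  define B where "B i = {f \<in> V \<rightarrow>\<^sub>E {1..}. semistandard (R (f \<circ> fst i)) (snd i)}"
    for i :: "(indet \<Rightarrow> indet) \<times> (nat \<Rightarrow> indet list)"
  have LHS: "schur_mzv lam (subst_tab lam (v \<circ> p) (tab T ?C)) * schur_mzv kap (subst_tab kap (v \<circ> p) (tab T ?B)) =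
      infsum (weight V v) (A p)" "weight V v summable_on A p" if p: "p permutes S" for p
  proof -
    note Wp = W_permute[OF p Re W(1)] W_permute[OF p Re W(2)]
    have "R (restrict f V1) u u' = R f u u'" if "u \<in> set (?C j)" "u' \<in> set (?C j')" for f u u' j j'
      using that fills(1) by (auto simp: R_def fills_def)
    then have 1: "semistandard (R (restrict f V1)) ?C = semistandard (R f) ?C" for f by (intro semistandard_cong)
    have "R (restrict f (set zs)) u u' = R f u u'" if "u \<in> set (?B j)" "u' \<in> set (?B j')" for f u u' j j'
      using that fills(2) by (auto simp: R_def fills_def)
    then have 2: "semistandard (R (restrict f (set zs))) ?B = semistandard (R f) ?B" for f by (intro semistandard_cong)
    note product = weight_product[OF fin schur_mzv_strips(2)[OF fills(1) lam Wp(1)]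
        schur_mzv_strips(2)[OF fills(2) kap Wp(2)], folded R_def V_def, unfolded 1 2]
    show "schur_mzv lam (subst_tab lam (v \<circ> p) (tab T ?C)) * schur_mzv kap (subst_tab kap (v \<circ> p) (tab T ?B)) =
        infsum (weight V v) (A p)"
      unfolding schur_mzv_strips(1)[OF fills(1) lam] schur_mzv_strips(1)[OF fills(2) kap] A_def
        infsum_weight_permute(1)[OF SV[OF p], of v "{1..}" "\<lambda>f. semistandard (R f) ?C \<and> semistandard (R f) ?B", symmetric]
      using product(2) by (simp only: R_def)
    show "weight V v summable_on A p"
      unfolding A_def
        infsum_weight_permute(2)[OF SV[OF p], of v "{1..}" "\<lambda>f. semistandard (R f) ?C \<and> semistandard (R f) ?B", symmetric]
      by (rule product(1))
  qed
  have RHS: "schur_mzv (shape (cells T C)) (subst_tab (shape (cells T C)) (v \<circ> p) (tab T C)) =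
      infsum (weight V v) (B (p, C))" if p: "p permutes S" and C: "C \<in> pushes zs 0 ?C" for p C
  proof -
    have f: "fills V C" using fills_pushes[OF fills(1) _ _ C] dist fin by (auto simp: V_def)
    have d: "diagram (shape (cells T C)) = cells T C"
      using shape(2) young_cells stacked_pushes[OF C stacked] by blast
    show ?thesis
      unfolding schur_mzv_strips(1)[OF f d] B_def fst_conv snd_conv R_def
      by (rule infsum_weight_permute(1)[OF SV[OF p]])
  qed
  have "card {p \<in> {p. p permutes S}. f \<in> A p} = card {i \<in> {p. p permutes S} \<times> pushes zs 0 ?C. f \<in> B i}" for f
  proof (cases "f \<in> V \<rightarrow>\<^sub>E {1..}")
    case True
    interpret strip_order "R f" unfolding R_def by (rule strip_order_along)
    have R: "R (f \<circ> p) = (\<lambda>u v. R f (p u) (p v))" for p by (simp add: R_def)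
    have "{p \<in> {p. p permutes S}. f \<in> A p} = {p. p permutes S \<and>
        semistandard (\<lambda>u v. R f (p u) (p v)) ?C \<and> semistandard (\<lambda>u v. R f (p u) (p v)) ?B}"
      using True by (auto simp: A_def R)
    then have "card {p \<in> {p. p permutes S}. f \<in> A p} =
        (\<Sum>C\<in>pushes zs 0 ?C. card {p. p permutes S \<and> semistandard (\<lambda>u v. R f (p u) (p v)) C})"
      using count_identity[OF dist ne q S] by simp
    also have "\<dots> = card (SIGMA C:pushes zs 0 ?C. {p. p permutes S \<and> semistandard (\<lambda>u v. R f (p u) (p v)) C})"
      using fin_pushes fin_perms by (subst card_SigmaI) (auto intro: finite_subset[OF _ fin_perms])
    also have "\<dots> = card {i \<in> {p. p permutes S} \<times> pushes zs 0 ?C. f \<in> B i}"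
      using True by (intro bij_betw_same_card[of prod.swap] bij_betwI[of _ _ _ prod.swap]) (auto simp: B_def R)
    finally show ?thesis .
  qed (simp add: A_def B_def)
  from sum_infsum_eq_by_multiplicity[OF fin_perms finite_cartesian_product[OF fin_perms fin_pushes] _ this, of "weight V v"]
  have "(\<Sum>p\<in>{p. p permutes S}. infsum (weight V v) (A p)) =
      (\<Sum>i\<in>{p. p permutes S} \<times> pushes zs 0 ?C. infsum (weight V v) (B i))"
    using LHS(2) by simp
  also have "\<dots> = (\<Sum>p\<in>{p. p permutes S}. \<Sum>C\<in>pushes zs 0 ?C. infsum (weight V v) (B (p, C)))"
    by (simp add: sum.cartesian_product)
  finally show ?thesis
    unfolding sum_sym_def using LHS(1) RHS by simp
qed

lemma sum_insertions:
  assumes "stacked C"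
  shows "(\<Sum>(mu, u)\<in>(\<lambda>C'. (shape (cells T C'), tab T C')) ` pushes ts c C. F mu u) =
    (\<Sum>C'\<in>pushes ts c C. F (shape (cells T C')) (tab T C'))"
proof -
  have "inj_on (\<lambda>C'. (shape (cells T C'), tab T C')) (pushes ts c C)"
    by (rule inj_on_subset[OF inj_shape_tab]) (use stacked_pushes assms in blast)
  then show ?thesis by (simp add: sum.reindex)
qed

text \<open>A hook whose first line is \<open>ys\<close> and whose first strip continues with \<open>x # xs\<close>, with columns and with rows as
  strips.\<close>
lemma hook_cells:
  assumes "0 < length ys"
  shows "diagram (length ys # replicate (Suc (length xs)) 1) = cells False (two_row ys [x] xs)"
    "diagram (Suc (Suc (length xs)) # replicate (length ys - 1) 1) = cells True (two_row ys [x] xs)"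
  using assms
  by (cases ys; auto simp: diagram_def cells_def two_row_def nth_Cons' Suc_le_eq split: if_splits)+

lemma strip_cells:
  "diagram [length zs] = cells False (two_row zs [] [])"
  "diagram (replicate (length zs) 1) = cells True (two_row zs [] [])"
  by (auto simp: diagram_def cells_def two_row_def nth_Cons' split: if_splits)

lemma map_upt_split: "0 < k \<Longrightarrow> map f [1..<Suc k] = f 1 # map f [2..<Suc k]"
  using upt_conv_Cons[of 1 "Suc k"] by (simp add: numeral_2_eq_2 del: upt_Suc)

lemma hook_H_eq_tab:
  assumes "0 < l" "0 < k"
  shows "diagram (l # replicate k 1) = cells False (two_row (map Y [1..<Suc l]) [X 1] (map X [2..<Suc k]))"
    "hook_H l k = tab False (two_row (map Y [1..<Suc l]) [X 1] (map X [2..<Suc k]))"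
proof -
  let ?C = "two_row (map Y [1..<Suc l]) [X 1] (map X [2..<Suc k])"
  show D: "diagram (l # replicate k 1) = cells False ?C"
    using hook_cells(1)[of "map Y [1..<Suc l]" "map X [2..<Suc k]" "X 1"] assms by (simp del: upt_Suc)
  have C: "?C = (\<lambda>j. if j = 0 then Y 1 # map X [1..<Suc k] else if j < l then [Y (Suc j)] else [])"
  proof -
    have ne: "map Y [1..<Suc l] \<noteq> []" and hd: "hd (map Y [1..<Suc l]) = Y 1"
      using map_upt_split[of l Y] assms by (simp_all del: upt_Suc)
    then show ?thesis
      unfolding two_row_hook[OF ne] hd map_upt_split[OF assms(2), symmetric]
      by (auto simp: fun_eq_iff simp del: upt_Suc)
  qed
  show "hook_H l k = tab False ?C"
    unfolding hook_H_def tab_def D unfolding C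
    by (rule restrict_ext) (auto simp: cells_def nth_Cons' simp del: upt_Suc split: if_splits)
qed

lemma hook_E_eq_tab:
  assumes "0 < l" "0 < k"
  shows "diagram ((l + 1) # replicate (k - 1) 1) =
      cells True (two_row (map X [1..<Suc k]) [Y 1] (map Y [2..<Suc l]))"
    "hook_E l k = tab True (two_row (map X [1..<Suc k]) [Y 1] (map Y [2..<Suc l]))"
proof -
  let ?C = "two_row (map X [1..<Suc k]) [Y 1] (map Y [2..<Suc l])"
  show D: "diagram ((l + 1) # replicate (k - 1) 1) = cells True ?C"
    using hook_cells(2)[of "map X [1..<Suc k]" "map Y [2..<Suc l]" "Y 1"] assms by (simp del: upt_Suc)
  have C: "?C = (\<lambda>j. if j = 0 then X 1 # map Y [1..<Suc l] else if j < k then [X (Suc j)] else [])"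
  proof -
    have ne: "map X [1..<Suc k] \<noteq> []" and hd: "hd (map X [1..<Suc k]) = X 1"
      using map_upt_split[of k X] assms by (simp_all del: upt_Suc)
    then show ?thesis
      unfolding two_row_hook[OF ne] hd map_upt_split[OF assms(1), symmetric]
      by (auto simp: fun_eq_iff simp del: upt_Suc)
  qed
  show "hook_E l k = tab True ?C"
    unfolding hook_E_def tab_def D unfolding C
    by (rule restrict_ext) (auto simp: cells_def nth_Cons' simp del: upt_Suc split: if_splits)
qed

lemma row_Z_eq_tab:
  "diagram [m] = cells False (two_row (map Z [1..<Suc m]) [] [])"
  "row_Z m = tab False (two_row (map Z [1..<Suc m]) [] [])"
proof -
  show D: "diagram [m] = cells False (two_row (map Z [1..<Suc m]) [] [])"
    using strip_cells(1)[of "map Z [1..<Suc m]"] by (simp del: upt_Suc)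
  show "row_Z m = tab False (two_row (map Z [1..<Suc m]) [] [])"
    unfolding row_Z_def tab_def D
    by (rule restrict_ext) (auto simp: two_row_def cells_def simp del: upt_Suc split: if_splits)
qed

lemma col_Z_eq_tab:
  "diagram (replicate m 1) = cells True (two_row (map Z [1..<Suc m]) [] [])"
  "col_Z m = tab True (two_row (map Z [1..<Suc m]) [] [])"
proof -
  show D: "diagram (replicate m 1) = cells True (two_row (map Z [1..<Suc m]) [] [])"
    using strip_cells(2)[of "map Z [1..<Suc m]"] by (simp del: upt_Suc)
  show "col_Z m = tab True (two_row (map Z [1..<Suc m]) [] [])"
    unfolding col_Z_def tab_def D
    by (rule restrict_ext) (auto simp: two_row_def cells_def simp del: upt_Suc split: if_splits)
qed

lemma set_take_letters: "set (take q (map f [1..<Suc m])) = f ` {1..min q m}"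
proof (cases "q \<le> m")
  case True
  then have "take q [1..<Suc m] = [1..<Suc q]" using take_upt[of 1 q "Suc m"] by simp
  then show ?thesis using True by (simp add: take_map atLeastLessThanSuc_atLeastAtMost del: upt_Suc)
next
  case False
  then show ?thesis by (simp add: atLeastLessThanSuc_atLeastAtMost del: upt_Suc)
qed

lemma letters_U:
  "map (\<lambda>j. row_Z m (1, j)) [1..<Suc m] = map Z [1..<Suc m]"
  "map (\<lambda>i. col_Z m (i, 1)) [1..<Suc m] = map Z [1..<Suc m]"
  by (auto simp: row_Z_def col_Z_def diagram_def simp del: upt_Suc)

lemma pushing_theorem_H:
  fixes x y z :: "nat \<Rightarrow> complex"
  assumes "0 < l" "0 < m" "0 < k"
    and S: "S = Y ` {1..l} \<union> Z ` {1..min (l - 1) m}" and v: "v = assign x y z"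
    and W: "subst_tab (l # replicate k 1) v (hook_H l k) \<in> W (l # replicate k 1)"
      "subst_tab [m] v (row_Z m) \<in> W [m]"
    and Re: "\<forall>i\<in>{1..l}. Re (y i) > 1" "\<forall>j\<in>{1..min (l - 1) m}. Re (z j) > 1"
  shows "sum_sym S v (\<lambda>w. schur_mzv (l # replicate k 1) (subst_tab (l # replicate k 1) w (hook_H l k)) *
      schur_mzv [m] (subst_tab [m] w (row_Z m))) =
    sum_sym S v (\<lambda>w. \<Sum>(mu, u)\<in>U_H (l # replicate k 1) (hook_H l k) m (row_Z m).
      schur_mzv mu (subst_tab mu w u))"
proof -
  let ?ys = "map Y [1..<Suc l]" and ?zs = "map Z [1..<Suc m]" and ?xs = "map X [2..<Suc k]"
  have p: "is_partition (l # replicate k 1)" using assms(1) by (auto simp: is_partition_def sorted_wrt_iff_nth_less nth_Cons')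
  have st: "stacked (two_row ?ys [X 1] ?xs)" using assms(1) by (intro stacked_hook) simp
  have U: "U_H (l # replicate k 1) (hook_H l k) m (row_Z m) =
      (\<lambda>C. (shape (cells False C), tab False C)) ` pushes ?zs 0 (two_row ?ys [X 1] ?xs)"
    unfolding U_H_def letters_U hook_H_eq_tab(2)[OF assms(1,3)]
    using row_insertions_eq[OF p _ hook_H_eq_tab(1)[OF assms(1,3)] st] by simp
  have "S = set ?ys \<union> set (take (min (length ?ys - 1) (length ?zs)) ?zs)"
    unfolding set_take_letters by (simp add: S atLeastLessThanSuc_atLeastAtMost del: upt_Suc)
  moreover have "distinct (?ys @ ?zs @ X 1 # ?xs)" by (auto simp: distinct_map inj_on_def)
  moreover have "\<forall>a\<in>S. 1 < Re (v a)" using Re by (auto simp: S v)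
  moreover have "?ys \<noteq> []" "?zs \<noteq> []" using assms by simp_all
  ultimately show ?thesis
    using W[unfolded hook_H_eq_tab(2)[OF assms(1,3)] row_Z_eq_tab(2)]
    unfolding U sum_insertions[OF st] unfolding hook_H_eq_tab(2)[OF assms(1,3)] row_Z_eq_tab(2)
    by (intro pushing_identity[OF _ _ _ refl _ hook_H_eq_tab(1)[OF assms(1,3)] row_Z_eq_tab(1)])
qed

lemma pushing_theorem_E:
  fixes x y z :: "nat \<Rightarrow> complex"
  assumes "0 < l" "0 < m" "0 < k"
    and S: "S = X ` {1..k} \<union> Z ` {1..min (k - 1) m}" and v: "v = assign x y z"
    and W: "subst_tab ((l + 1) # replicate (k - 1) 1) v (hook_E l k) \<in> W ((l + 1) # replicate (k - 1) 1)"
      "subst_tab (replicate m 1) v (col_Z m) \<in> W (replicate m 1)"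
    and Re: "\<forall>i\<in>{1..k}. Re (x i) > 1" "\<forall>j\<in>{1..min (k - 1) m}. Re (z j) > 1"
  shows "sum_sym S v (\<lambda>w. schur_mzv ((l + 1) # replicate (k - 1) 1)
        (subst_tab ((l + 1) # replicate (k - 1) 1) w (hook_E l k)) *
      schur_mzv (replicate m 1) (subst_tab (replicate m 1) w (col_Z m))) =
    sum_sym S v (\<lambda>w. \<Sum>(mu, u)\<in>U_E ((l + 1) # replicate (k - 1) 1) (hook_E l k) m (col_Z m).
      schur_mzv mu (subst_tab mu w u))"
proof -
  let ?ys = "map X [1..<Suc k]" and ?zs = "map Z [1..<Suc m]" and ?xs = "map Y [2..<Suc l]"
  have p: "is_partition ((l + 1) # replicate (k - 1) 1)" by (auto simp: is_partition_def sorted_wrt_iff_nth_less nth_Cons')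
  have st: "stacked (two_row ?ys [Y 1] ?xs)" using assms(3) by (intro stacked_hook) simp
  have U: "U_E ((l + 1) # replicate (k - 1) 1) (hook_E l k) m (col_Z m) =
      (\<lambda>C. (shape (cells True C), tab True C)) ` pushes ?zs 0 (two_row ?ys [Y 1] ?xs)"
    unfolding U_E_def letters_U hook_E_eq_tab(2)[OF assms(1,3)]
    using col_insertions_eq[OF p _ hook_E_eq_tab(1)[OF assms(1,3)] st] by simp
  have "S = set ?ys \<union> set (take (min (length ?ys - 1) (length ?zs)) ?zs)"
    unfolding set_take_letters by (simp add: S atLeastLessThanSuc_atLeastAtMost del: upt_Suc)
  moreover have "distinct (?ys @ ?zs @ Y 1 # ?xs)" by (auto simp: distinct_map inj_on_def)
  moreover have "\<forall>a\<in>S. 1 < Re (v a)" using Re by (auto simp: S v)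
  moreover have "?ys \<noteq> []" "?zs \<noteq> []" using assms by simp_all
  ultimately show ?thesis
    using W[unfolded hook_E_eq_tab(2)[OF assms(1,3)] col_Z_eq_tab(2)]
    unfolding U sum_insertions[OF st] unfolding hook_E_eq_tab(2)[OF assms(1,3)] col_Z_eq_tab(2)
    by (intro pushing_identity[OF _ _ _ refl _ hook_E_eq_tab(1)[OF assms(1,3)] col_Z_eq_tab(1)])
qed

theorem theorem1p2:
  fixes l m k :: nat
  assumes "0 < l" and "0 < m" and "0 < k"
  shows
    "(\<forall>x y z :: nat \<Rightarrow> complex.
        let lam = l # replicate k 1; s = hook_H l k; t = row_Z m; v = assign x y z;
            S = Y ` {1..l} \<union> Z ` {1..min (l - 1) m}
        in subst_tab lam v s \<in> W lam \<longrightarrow>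
           subst_tab [m] v t \<in> W [m] \<longrightarrow>
           (\<forall>i\<in>{1..l}. Re (y i) > 1) \<longrightarrow>
           (\<forall>j\<in>{1..min (l - 1) m}. Re (z j) > 1) \<longrightarrow>
           sum_sym S v (\<lambda>w. schur_mzv lam (subst_tab lam w s) * schur_mzv [m] (subst_tab [m] w t)) =
           sum_sym S v (\<lambda>w. \<Sum>(mu, u)\<in>U_H lam s m t. schur_mzv mu (subst_tab mu w u))) \<and>
     (\<forall>x y z :: nat \<Rightarrow> complex.
        let lam = (l + 1) # replicate (k - 1) 1; s = hook_E l k;
            kap = replicate m 1; t = col_Z m; v = assign x y z;
            S = X ` {1..k} \<union> Z ` {1..min (k - 1) m}
        in subst_tab lam v s \<in> W lam \<longrightarrow>
           subst_tab kap v t \<in> W kap \<longrightarrow>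
           (\<forall>i\<in>{1..k}. Re (x i) > 1) \<longrightarrow>
           (\<forall>j\<in>{1..min (k - 1) m}. Re (z j) > 1) \<longrightarrow>
           sum_sym S v (\<lambda>w. schur_mzv lam (subst_tab lam w s) * schur_mzv kap (subst_tab kap w t)) =
           sum_sym S v (\<lambda>w. \<Sum>(mu, u)\<in>U_E lam s m t. schur_mzv mu (subst_tab mu w u)))"
  using pushing_theorem_H[OF assms] pushing_theorem_E[OF assms] by (simp add: Let_def)

end
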